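(* Let $\{\mathbb{Q}_\beta\}$ be a family of translation-invariant self-interacting random walks on $\mathbb{Z}^d$ of range at most $L$, as in the context, whose expansion coefficients satisfy the following Assumption (LLN): there exist a sequence $\{b_m\}_{m\ge1}$, independent of $\beta$, with $b_1\ge1$, and a constant $\varepsilon_\beta=\varepsilon_\beta(d)$ with $\lim_{\beta\to0}\varepsilon_\beta=0$, such that for all $m\ge2$, $$\hat\pi_m(0)=0,\qquad|\nabla\hat\pi_m(0)|\le\varepsilon_\beta b_m,\qquad|\nabla^2\hat\pi_m(0)|\le\varepsilon_\beta m b_m,$$ and, uniformly in $k\in[-\pi,\pi]^d$, $$|\hat\pi_m(k)|\le\varepsilon_\beta|k|b_m,\qquad|\hat\pi_m(k)-k\cdot\nabla\hat\pi_m(0)|\le\varepsilon_\beta|k|^2mb_m,$$ where $$\sum_{m=1}^\infty b_m<\infty\quad\text{and}\quad\sup_n\frac{(\log(n\vee3))^2}{n}\sum_{m=1}^n mb_m<\infty.$$ Then there exist $\beta_0=\beta_0(d)>0$ and $\theta=\theta(\beta)$ such that for all $\beta\le\beta_0$, $$\mathbb{E}_\beta[\omega_n]=\theta n\Big[1+O\Big(\frac1n\sum_{m=1}^\infty(n\wedge m)b_m\Big)\Big].$$ Furthermore, there exists $C>0$ such that for every $k\in\mathbb{R}^d$, $$\log\Big(\mathbb{E}_\beta\big[e^{ik\cdot\omega_n/n}\big]\Big)=ik\cdot\theta+O\Big(\frac{|k|}{n}e^{C|k|}\sum_{m=1}^\infty(n\wedge m)b_m\Big)+O\Big(\frac{|k|^2}{n}\sum_{m=1}^n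 mb_m\Big).$$ The (model-dependent) constant $\theta$ is given by $$\theta=\theta(\beta)=\sum_{x}xD(x)-i\sum_{m=2}^\infty\nabla\hat\pi_m(0).$$
   Context: Notation: $n$ ranges over the positive integers. $O(g)$ denotes a quantity bounded in absolute value by a constant multiple of $g$, the constant not depending on $n$ or $k$. $a\wedge b=\min(a,b)$, $a\vee b=\max(a,b)$. Self-interacting random walks. The parameter $\beta\ge 0$ indexes a family of walks; $\beta$ is suppressed in $p$, $D$, $\pi_m$. A finite path is $\vec{x}_i=(x_0,\dots,x_i)$ with $x_j\in\mathbb{Z}^d$. For every finite path $\vec{x}_i$ a probability mass function $y\mapsto p^{\vec{x}_i}(x_i,y)$ on $\mathbb{Z}^d$ is given (the conditional probability of stepping from $x_i$ to $y$ given the history $\vec{x}_i$). It is translation invariant, i.e. unchanged when the whole path and $y$ are shifted by the same vector, and has finite range: $p^{\vec{x}_i}(x_i,y)=0$ if $|y-x_i|>L$, with $L<\infty$ independent of $\beta$. The walk $\vec\omega=(\omega_0,\omega_1,\dots)$ started at the origin $o$ has law $\mathbb{Q}_\beta$ (expectation $\mathbb{E}_\beta$) given by $\mathbb{Q}_\beta(\vec\omega_n=(x_0,\dots,x_n))=\prod_{i=0}^{n-1}p^{\vec{x}_i}(x_i,x_{i+1})$ for $x_0=o$, where $\vec\omega_n=(\omega_0,\dots,\omega_n)$. Write $D(x)=p^{o}(o,x)$. Concatenation. If $\vec\eta_j=(\eta_0,\dots,\eta_j)$ and $\vec{x}_m=(x_0,\dots,x_m)$ with $\eta_j=x_0$,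 then $\vec\eta_j\circ\vec{x}_m=(\eta_0,\dots,\eta_j,x_1,\dots,x_m)$. Expansion coefficients. For $N\ge1$ and $m\ge 2$ let $\mathcal{A}_{m,N}=\{(j_1,\dots,j_N)\in\mathbb{Z}_{\ge0}^N: j_1+\dots+j_N=m-N-1\}$ and set $j_0=0$. For $\vec{j}\in\mathcal{A}_{m,N}$ consider paths $\vec\omega^{(0)}_1=(o,\omega^{(0)}_1)$ and, for $n=1,\dots,N$, $\vec\omega^{(n)}_{j_n+1}=(\omega^{(n)}_0,\dots,\omega^{(n)}_{j_n+1})$ with $\omega^{(n)}_0=\omega^{(n-1)}_{j_{n-1}+1}$; $\vec\omega^{(n)}_i$ denotes the first $i$ steps of $\vec\omega^{(n)}_{j_n+1}$. Put $$\Delta^{(n)}_{j_n+1}=\Big(p^{\vec\omega^{(n-1)}_{j_{n-1}+1}\circ\vec\omega^{(n)}_{j_n}}-p^{\vec\omega^{(n)}_{j_n}}\Big)\big(\omega^{(n)}_{j_n},\omega^{(n)}_{j_n+1}\big),$$ $$\pi_m^{(N)}(y)=\sum_{\vec{j}\in\mathcal{A}_{m,N}}\ \sum_{\vec\omega^{(0)}_1}\sum_{\vec\omega^{(1)}_{j_1+1}}\cdots\sum_{\vec\omega^{(N)}_{j_N+1}} I_{\{\omega^{(N)}_{j_N+1}=y\}}\,D(\omega^{(0)}_1)\prod_{n=1}^N\Delta^{(n)}_{j_n+1}\prod_{i=0}^{j_n-1}p^{\vec\omega^{(n-1)}_{j_{n-1}+1}\circ\vec\omega^{(n)}_{i}}\big(\omega^{(n)}_i,\omega^{(n)}_{i+1}\big),$$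 the sums being over all such paths and empty products being $1$; $\pi_m(y)=\sum_{N=1}^\infty\pi_m^{(N)}(y)$ (the terms with $N+1>m$ vanish). The Fourier transform is $\hat\pi_m(k)=\sum_{x}e^{ik\cdot x}\pi_m(x)$; $\nabla$ and $\nabla^2$ denote the gradient and the matrix of second derivatives in $k$, and the norm of a matrix is the sum of the absolute values of its entries.
   Formalization: The mean's relative error is taken in norm, for θ≠0 (absolute bound O(Σ(n∧m)b_m) always); log is the continuous branch, its bound needs |E e^{itk·ω_n/n}|≥η for t in [0,1], constant depending on η (η=1/2 holds if |k|≤δ log(n∨3)); b_m≥0. *)

theory Defs
  imports "HOL-Probability.Probability"
begin

definition rvec :: "int ^ 'd \<Rightarrow> real ^ 'd" where
  "rvec x = (\<chi> a. real_of_int (x $ a))"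

definition cvec :: "real ^ 'd \<Rightarrow> complex ^ 'd" where
  "cvec v = (\<chi> a. complex_of_real (v $ a))"

text \<open>
  A path \<open>(x\<^sub>0, \<dots>, x\<^sub>i)\<close> is the nonempty list of its \<open>i + 1\<close> vertices.  A step law \<open>p\<close> maps a path \<open>xs\<close>
  to the distribution of the next vertex, so \<open>pmf (p xs) y\<close> is the probability of stepping from
  \<open>last xs\<close> to \<open>y\<close> given the history \<open>xs\<close>; its value on \<open>[]\<close> is irrelevant.
\<close>

type_synonym 'd step_law = "(int ^ 'd) list \<Rightarrow> (int ^ 'd) pmf"

definition translation_invariant :: "('d::finite) step_law \<Rightarrow> bool" where
  "translation_invariant p \<longleftrightarrow>
     (\<forall>xs v y. xs \<noteq> [] \<longrightarrow> pmf (p (map (\<lambda>x. x + v) xs)) (y + v) = pmf (p xs) y)"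

definition range_at_most :: "real \<Rightarrow> ('d::finite) step_law \<Rightarrow> bool" where
  "range_at_most L p \<longleftrightarrow>
     (\<forall>xs y. xs \<noteq> [] \<longrightarrow> norm (rvec (y - last xs)) > L \<longrightarrow> pmf (p xs) y = 0)"

definition is_walk_law :: "('d::finite) step_law \<Rightarrow> (nat \<Rightarrow> int ^ 'd) measure \<Rightarrow> bool" where
  "is_walk_law p Q \<longleftrightarrow>
     prob_space Q \<and>
     sets Q = sets (\<Pi>\<^sub>M i\<in>(UNIV :: nat set). count_space (UNIV :: (int ^ 'd) set)) \<and>
     (\<forall>n xs. length xs = n + 1 \<longrightarrow> xs ! 0 = 0 \<longrightarrow>
        measure Q {\<omega> \<in> space Q. \<forall>i\<le>n. \<omega> i = xs ! i} =
          (\<Prod>i<n. pmf (p (take (i + 1) xs)) (xs ! (i + 1))))"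

definition mean_position :: "(nat \<Rightarrow> int ^ 'd) measure \<Rightarrow> nat \<Rightarrow> real ^ 'd::finite" where
  "mean_position Q n = (\<integral>\<omega>. rvec (\<omega> n) \<partial>Q)"

definition scaled_char :: "(nat \<Rightarrow> int ^ 'd) measure \<Rightarrow> nat \<Rightarrow> real ^ 'd::finite \<Rightarrow> complex" where
  "scaled_char Q n k = (\<integral>\<omega>. exp (\<i> * complex_of_real (k \<bullet> rvec (\<omega> n) / real n)) \<partial>Q)"

definition first_step :: "('d::finite) step_law \<Rightarrow> int ^ 'd \<Rightarrow> real" where
  "first_step p x = pmf (p [0]) x"

definition path_concat :: "(int ^ 'd) list \<Rightarrow> (int ^ 'd) list \<Rightarrow> (int ^ 'd) list" where
  "path_concat \<eta> xs = \<eta> @ tl xs"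

text \<open>
  The equation \<open>sum_list js + N + 1 = m\<close> (rather than truncated subtraction) makes the index set empty
  when \<open>N + 1 > m\<close>.  The entry \<open>j\<^sub>n\<close> is \<open>js ! (n - 1)\<close>, that is \<open>(0 # js) ! n\<close>, where the
  leading \<open>0\<close> is \<open>j\<^sub>0\<close>.
\<close>

definition expansion_index :: "nat \<Rightarrow> nat \<Rightarrow> nat list set" where
  "expansion_index m N = {js. length js = N \<and> sum_list js + N + 1 = m}"

text \<open>
  A member \<open>W\<close> of \<open>path_families js\<close> lists the paths of the superscripts \<open>0, \<dots>, N\<close>, the one at \<open>n\<close> having
  \<open>j\<^sub>n + 1\<close> steps, hence \<open>j\<^sub>n + 2\<close> vertices.  The first \<open>i\<close> steps of \<open>W ! n\<close> are
  \<open>take (i + 1) (W ! n)\<close>.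
\<close>

definition path_families :: "nat list \<Rightarrow> (int ^ 'd) list list set" where
  "path_families js =
     {W. length W = length js + 1 \<and>
         (\<forall>n\<le>length js. length (W ! n) = (0 # js) ! n + 2) \<and>
         hd (W ! 0) = 0 \<and>
         (\<forall>n\<in>{1..length js}. hd (W ! n) = last (W ! (n - 1)))}"

definition Delta :: "('d::finite) step_law \<Rightarrow> nat list \<Rightarrow> (int ^ 'd) list list \<Rightarrow> nat \<Rightarrow> real" where
  "Delta p js W n =
     (let j = (0 # js) ! n; xs = take (j + 1) (W ! n); y = (W ! n) ! (j + 1)
      in pmf (p (path_concat (W ! (n - 1)) xs)) y - pmf (p xs) y)"

text \<open>
  By the finite range only finitely many \<open>W\<close> contribute, but the index set is infinite, whence \<open>infsum\<close>.
\<close>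

definition pi_coeff_N :: "('d::finite) step_law \<Rightarrow> nat \<Rightarrow> nat \<Rightarrow> int ^ 'd \<Rightarrow> real" where
  "pi_coeff_N p m N y =
     (\<Sum>js\<in>expansion_index m N. \<Sum>\<^sub>\<infinity>W\<in>path_families js.
        (if (W ! N) ! ((0 # js) ! N + 1) = y then 1 else 0) *
        first_step p ((W ! 0) ! 1) *
        (\<Prod>n=1..N. Delta p js W n *
           (\<Prod>i<(0 # js) ! n.
              pmf (p (path_concat (W ! (n - 1)) (take (i + 1) (W ! n)))) ((W ! n) ! (i + 1)))))"

definition pi_coeff :: "('d::finite) step_law \<Rightarrow> nat \<Rightarrow> int ^ 'd \<Rightarrow> real" where
  "pi_coeff p m y = (\<Sum>N. pi_coeff_N p m (N + 1) y)"

definition pi_hat :: "('d::finite) step_law \<Rightarrow> nat \<Rightarrow> real ^ 'd \<Rightarrow> complex" where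
  "pi_hat p m k =
     (\<Sum>\<^sub>\<infinity>x. exp (\<i> * complex_of_real (k \<bullet> rvec x)) * complex_of_real (pi_coeff p m x))"

definition partial_deriv :: "'d::finite \<Rightarrow> (real ^ 'd \<Rightarrow> complex) \<Rightarrow> real ^ 'd \<Rightarrow> complex" where
  "partial_deriv a f k = vector_derivative (\<lambda>t. f (k + t *\<^sub>R axis a 1)) (at 0)"

definition gradient :: "(real ^ 'd \<Rightarrow> complex) \<Rightarrow> real ^ 'd::finite \<Rightarrow> complex ^ 'd" where
  "gradient f k = (\<chi> a. partial_deriv a f k)"

definition hessian :: "(real ^ 'd \<Rightarrow> complex) \<Rightarrow> real ^ 'd::finite \<Rightarrow> complex ^ 'd ^ 'd" where
  "hessian f k = (\<chi> a c. partial_deriv a (partial_deriv c f) k)"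

definition matrix_norm :: "complex ^ 'd ^ 'd::finite \<Rightarrow> real" where
  "matrix_norm A = (\<Sum>a\<in>UNIV. \<Sum>c\<in>UNIV. cmod (A $ a $ c))"

text \<open>
  The bilinear (not Hermitian) product of a real with a complex vector.
\<close>

definition cdot :: "real ^ 'd \<Rightarrow> complex ^ 'd::finite \<Rightarrow> complex" where
  "cdot k v = (\<Sum>a\<in>UNIV. complex_of_real (k $ a) * v $ a)"

text \<open>
  Only the values \<open>b m\<close> with \<open>m \<ge> 1\<close> matter.  Being a sequence of bounds, \<open>b\<close> is nonnegative; this has
  to be said because \<open>\<epsilon>\<close> might vanish.
\<close>

definition assumption_LLN ::
    "(real \<Rightarrow> ('d::finite) step_law) \<Rightarrow> (nat \<Rightarrow> real) \<Rightarrow> (real \<Rightarrow> real) \<Rightarrow> bool" where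
  "assumption_LLN p b \<epsilon> \<longleftrightarrow>
     b 1 \<ge> 1 \<and> (\<forall>m\<ge>1. b m \<ge> 0) \<and>
     (\<epsilon> \<longlongrightarrow> 0) (at_right 0) \<and>
     (\<forall>\<beta>\<ge>0. \<forall>m\<ge>2.
        pi_hat (p \<beta>) m 0 = 0 \<and>
        norm (gradient (pi_hat (p \<beta>) m) 0) \<le> \<epsilon> \<beta> * b m \<and>
        matrix_norm (hessian (pi_hat (p \<beta>) m) 0) \<le> \<epsilon> \<beta> * real m * b m \<and>
        (\<forall>k. (\<forall>a. k $ a \<in> {- pi..pi}) \<longrightarrow>
           cmod (pi_hat (p \<beta>) m k) \<le> \<epsilon> \<beta> * norm k * b m \<and>
           cmod (pi_hat (p \<beta>) m k - cdot k (gradient (pi_hat (p \<beta>) m) 0))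
             \<le> \<epsilon> \<beta> * (norm k)\<^sup>2 * real m * b m)) \<and>
     summable (\<lambda>m. b (m + 1)) \<and>
     bdd_above ((\<lambda>n. (ln (real (max n 3)))\<^sup>2 / real n * (\<Sum>m=1..n. real m * b m)) ` {1..})"

definition truncated_mass :: "(nat \<Rightarrow> real) \<Rightarrow> nat \<Rightarrow> real" where
  "truncated_mass b n = (\<Sum>m. real (min n (m + 1)) * b (m + 1))"

text \<open>
  The logarithm of a characteristic function \<open>f\<close> at \<open>k\<close> is the distinguished one: the continuous branch
  along the segment from \<open>0\<close>, where it vanishes, to \<open>k\<close>.  It exists and is unique when \<open>f\<close> is continuous with
  \<open>f 0 = 1\<close> and has no zero on that segment.  The principal branch \<open>Ln\<close> would not do, since
  its imaginary part is confined to \<open>(-\<pi>, \<pi>]\<close>.  The logarithm is undefined at the zeros of \<open>f\<close> and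
  unbounded near them, so estimates for it can be uniform in \<open>k\<close> only where \<open>f\<close> is bounded away from \<open>0\<close>.
\<close>

definition distinguished_log :: "(real ^ 'd \<Rightarrow> complex) \<Rightarrow> real ^ 'd::finite \<Rightarrow> complex" where
  "distinguished_log f k =
     (THE w. \<exists>g :: real \<Rightarrow> complex. continuous_on {0..1} g \<and> g 0 = 0 \<and> g 1 = w \<and>
               (\<forall>t\<in>{0..1}. exp (g t) = f (t *\<^sub>R k)))"

end

theory Submission
  imports Defs
begin

text \<open>
  Write \<open>\<phi>\<^sub>n\<close> for the characteristic function of the position after \<open>n\<close> steps, and \<open>D'\<close> and \<open>\<pi>'\<^sub>m\<close> for the
  Fourier transforms of the law of the first step and of the expansion coefficients.

  The expansion.  After a piece of path has been walked, compare the walk that remembers it with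
  the walk that starts afresh at its endpoint.  The difference of the two path probabilities is a
  difference of two products, which telescopes over the time \<open>j\<close> at which the factor is
  switched; the walk after that time remembers only the \<open>j + 1\<close> steps made since the
  fresh start, and the comparison can be iterated.  Started after the first step, this gives
  \<open>\<phi>\<^sub>n\<^sub>+\<^sub>1 = D' \<phi>\<^sub>n + \<Sum>\<^sub>m \<pi>'\<^sub>m \<phi>\<^sub>n\<^sub>+\<^sub>1\<^sub>-\<^sub>m\<close>, the sum being over \<open>2 \<le> m \<le> n + 1\<close>
  (\<open>char_recursion\<close>).  By the finite range every sum over paths is finite.

  The mean.  The gradient of \<open>\<pi>'\<^sub>m\<close> at \<open>0\<close> is \<open>\<i> g\<^sub>m\<close> with a real vector \<open>g\<^sub>m\<close> (\<open>drift m\<close> below), so \<open>\<theta>\<close>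
  is real.  Since \<open>\<pi>'\<^sub>m\<close> vanishes at \<open>0\<close>, differentiation of the recursion at \<open>0\<close> shows that the \<open>j\<close>-th increment of
  the mean differs from \<open>\<theta>\<close> only by the tail of \<open>\<Sum> g\<^sub>m\<close> beyond \<open>j + 1\<close>.
  The tails of \<open>\<Sum> b\<^sub>m\<close> beyond \<open>j\<close>, summed over \<open>j < n\<close>, are \<open>\<Sum> (n \<and> m) b\<^sub>m\<close>.

  The characteristic function.  Put \<open>u\<^sub>j = \<phi>\<^sub>j exp(- \<i> j k\<bullet>\<theta>)\<close>.  Its modulus is at most \<open>1\<close> from
  the outset, since \<open>\<theta>\<close> is real.  The recursion therefore gives at once that \<open>u\<close> has increments
  \<open>O(|k|)\<close>.  With this, each \<open>u\<^sub>j\<^sub>+\<^sub>1\<^sub>-\<^sub>m\<close> in the recursion can be replaced by \<open>u\<^sub>j\<close> at the cost \<open>O(m |k|)\<close>,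
  and the resulting coefficient of \<open>u\<^sub>j\<close> is, to first order in \<open>k\<close>, a tail of \<open>\<Sum> g\<^sub>m\<close> again.
  Summation over \<open>j\<close> bounds \<open>u\<^sub>n - 1\<close> by a multiple of \<open>|k| \<Sum> (n \<and> m) b\<^sub>m + n |k|\<^sup>2 \<Sum> m b\<^sub>m\<close>
  (\<open>deviation_bound\<close>).

  The logarithm.  Replace \<open>k\<close> by \<open>k/n\<close>.  The bound on \<open>\<Sum> m b\<^sub>m\<close> implies \<open>\<Sum> (n \<and> m) b\<^sub>m = O(n / log n)\<close>
  (\<open>tail_sum_le\<close>), so that \<open>u\<^sub>n - 1\<close> is small as long as \<open>|k| \<le> \<delta> log n\<close>.  In this region the logarithm is
  \<open>\<i> k\<bullet>\<theta>\<close> plus the principal logarithm of \<open>u\<^sub>n\<close>.  For larger \<open>k\<close>, the factor \<open>exp(|k|/\<delta>)\<close> is at least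
  \<open>n\<close>, so that the first error term dominates \<open>|k|\<close>, and it is enough to integrate the logarithmic
  derivative along the segment from \<open>0\<close> to \<open>k\<close>.
\<close>

section \<open>Plane waves and finite-range paths\<close>

definition wave :: "real ^ 'd::finite \<Rightarrow> int ^ 'd \<Rightarrow> complex" where
  "wave k x = exp (\<i> * complex_of_real (k \<bullet> rvec x))"

lemma rvec_add: "rvec (x + y) = rvec x + rvec y"
  and rvec_zero [simp]: "rvec 0 = 0"
  by (simp_all add: rvec_def vec_eq_iff)

lemma wave_zero [simp]: "wave k 0 = 1" "wave 0 x = 1"
  by (simp_all add: wave_def)

lemma wave_add: "wave k (x + y) = wave k x * wave k y"
  by (simp add: wave_def rvec_add inner_add_right distrib_left exp_add)

lemma norm_wave [simp]: "cmod (wave k x) = 1"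
  by (simp add: wave_def)

definition steps :: "real \<Rightarrow> (int ^ 'd::finite) set" where
  "steps L = {v. norm (rvec v) \<le> L}"

lemma finite_steps [simp, intro]: "finite (steps L :: (int ^ 'd::finite) set)"
proof -
  define N where "N = \<lceil>L\<rceil>"
  have "vec_nth ` (steps L :: (int ^ 'd) set) \<subseteq> (UNIV \<rightarrow>\<^sub>E {-N..N})"
  proof safe
    fix v :: "int ^ 'd" and a assume "v \<in> steps L"
    then have "\<bar>rvec v $ a\<bar> \<le> L"
      using component_le_norm_cart[of "rvec v" a] by (simp add: steps_def)
    then have "\<bar>real_of_int (v $ a)\<bar> \<le> of_int N"
      by (simp add: rvec_def N_def) linarith
    then show "v $ a \<in> {-N..N}" by auto
  qed auto
  moreover have "finite (UNIV \<rightarrow>\<^sub>E {-N..N} :: ('d \<Rightarrow> int) set)"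
    by (intro finite_PiE) auto
  ultimately have "finite (vec_nth ` (steps L :: (int ^ 'd) set))"
    by (rule finite_subset)
  then show ?thesis
    by (rule finite_imageD) (auto intro: inj_onI simp: vec_nth_inject)
qed

text \<open>
  The vertices after the starting point \<open>z\<close>, which is left out, of the paths of \<open>n\<close> steps.
\<close>
primrec paths :: "real \<Rightarrow> nat \<Rightarrow> int ^ 'd::finite \<Rightarrow> (int ^ 'd) list set" where
  "paths L 0 z = {[]}"
| "paths L (Suc n) z = (\<lambda>(v, V). (z + v) # V) ` Sigma (steps L) (\<lambda>v. paths L n (z + v))"

lemma finite_paths [simp, intro]: "finite (paths L n z)"
  by (induction n arbitrary: z) auto

lemma sum_paths_Suc:
  fixes g :: "_ \<Rightarrow> 'b::comm_monoid_add"
  shows "(\<Sum>V\<in>paths L (Suc n) z. g V) = (\<Sum>v\<in>steps L. \<Sum>V\<in>paths L n (z + v). g ((z + v) # V))"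
proof -
  have "inj_on (\<lambda>(v, V). (z + v) # V) (Sigma (steps L) (\<lambda>v. paths L n (z + v)))"
    by (auto intro!: inj_onI)
  then show ?thesis
    by (simp add: sum.reindex sum.Sigma case_prod_unfold o_def)
qed

lemma length_paths: "V \<in> paths L n z \<Longrightarrow> length V = n"
  by (induction n arbitrary: V z) auto

lemma not_in_paths:
  "length V = n \<Longrightarrow> V \<notin> paths L n z \<Longrightarrow> \<exists>i<n. V ! i - (z # V) ! i \<notin> steps L"
proof (induction n arbitrary: V z)
  case (Suc n)
  then obtain y U where V: "V = y # U" "length U = n" by (cases V) auto
  show ?case
  proof (cases "y - z \<in> steps L")
    case True
    have "U \<notin> paths L n y"
    proof
      assume "U \<in> paths L n y"
      with True have "V = (\<lambda>(v, V). (z + v) # V) (y - z, U)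
          \<and> (y - z, U) \<in> Sigma (steps L) (\<lambda>v. paths L n (z + v))"
        by (simp add: V)
      then show False using Suc.prems(2) unfolding paths.simps by blast
    qed
    from Suc.IH[OF V(2) this] obtain i where "i < n" "U ! i - (y # U) ! i \<notin> steps L" by auto
    then show ?thesis by (intro exI[of _ "Suc i"]) (auto simp: V)
  qed (auto simp: V intro!: exI[of _ 0])
qed simp

text \<open>
  A history that ends in \<open>z\<close>, continued by the first \<open>i\<close> vertices of a path from \<open>z\<close>, ends in the
  \<open>i\<close>-th vertex of that path.
\<close>
lemma last_append_take:
  assumes "i \<le> length V" "last \<eta> = z" shows "last (\<eta> @ take i V) = (z # V) ! i"
  using assms by (cases i) (auto simp: take_Suc_conv_app_nth)

locale finite_range_law =
  fixes p :: "('d::finite) step_law" and L :: real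
  assumes translation: "translation_invariant p" and finite_range: "range_at_most L p"
begin

lemma pmf_zero: "xs \<noteq> [] \<Longrightarrow> y - last xs \<notin> steps L \<Longrightarrow> pmf (p xs) y = 0"
  using finite_range by (auto simp: range_at_most_def steps_def)

lemma sum_pmf_steps: 
  assumes "xs \<noteq> []" shows "(\<Sum>v\<in>steps L. pmf (p xs) (last xs + v)) = 1"
proof -
  have "set_pmf (p xs) \<subseteq> (+) (last xs) ` steps L"
  proof
    fix y assume "y \<in> set_pmf (p xs)"
    then have "y - last xs \<in> steps L"
      using pmf_zero[OF assms] by (auto simp: set_pmf_iff)
    then show "y \<in> (+) (last xs) ` steps L"
      by (intro image_eqI[of _ _ "y - last xs"]) auto
  qed
  then have "sum (pmf (p xs)) ((+) (last xs) ` steps L) = 1"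
    by (intro sum_pmf_eq_1) auto
  then show ?thesis by (subst (asm) sum.reindex) auto
qed

section \<open>Expanding the characteristic function\<close>

text \<open>
  The characteristic function of the displacement made in the next \<open>n\<close> steps of the walk with
  history \<open>\<eta>\<close>.
\<close>
primrec char_from :: "real ^ 'd \<Rightarrow> nat \<Rightarrow> (int ^ 'd) list \<Rightarrow> complex" where
  "char_from k 0 \<eta> = 1"
| "char_from k (Suc n) \<eta> = (\<Sum>v\<in>steps L. of_real (pmf (p \<eta>) (last \<eta> + v)) * wave k v *
     char_from k n (\<eta> @ [last \<eta> + v]))"

lemma char_from_translate:
  "\<eta> \<noteq> [] \<Longrightarrow> char_from k n (map (\<lambda>x. x + z) \<eta>) = char_from k n \<eta>"
proof (induction n arbitrary: \<eta>)
  case (Suc n)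
  have "pmf (p (map (\<lambda>x. x + z) \<eta>)) (last \<eta> + z + v) = pmf (p \<eta>) (last \<eta> + v)" for v
    using translation Suc.prems unfolding translation_invariant_def
    by (metis add.assoc add.commute)
  moreover have "char_from k n (map (\<lambda>x. x + z) \<eta> @ [last \<eta> + z + v]) = char_from k n (\<eta> @ [last \<eta> + v])" for v
    using Suc.IH[of "\<eta> @ [last \<eta> + v]"] by (simp add: add_ac)
  ultimately show ?case
    using Suc.prems by (simp add: last_map)
qed simp

lemma char_from_singleton: "char_from k n [z] = char_from k n [0]"
  using char_from_translate[of "[0]" k n z] by simp

lemma norm_char_from_le_1: "\<eta> \<noteq> [] \<Longrightarrow> cmod (char_from k n \<eta>) \<le> 1"
proof (induction n arbitrary: \<eta>)
  case (Suc n)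
  have "cmod (char_from k (Suc n) \<eta>) \<le> (\<Sum>v\<in>steps L. pmf (p \<eta>) (last \<eta> + v))"
    unfolding char_from.simps
    by (intro sum_norm_le) (auto simp: norm_mult intro!: mult_left_le Suc.IH)
  with sum_pmf_steps[OF Suc.prems] show ?case by simp
qed simp

text \<open>
  Two walks stand at the same vertex, with the long history \<open>\<eta>\<close> and with its recent part \<open>x\<close>.  The
  correction sums over \<open>j + 1\<close> further steps; the first \<open>j\<close> have the law for \<open>\<eta>\<close>, the last one
  carries the difference of the two laws, and \<open>f\<close> is evaluated at the extended
  recent history.
\<close>
primrec correction :: "real ^ 'd \<Rightarrow> nat \<Rightarrow> (int ^ 'd) list \<Rightarrow> (int ^ 'd) list \<Rightarrow> ((int ^ 'd) list \<Rightarrow> complex) \<Rightarrow> complex" where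
  "correction k 0 \<eta> x f = (\<Sum>v\<in>steps L. of_real (pmf (p \<eta>) (last x + v) - pmf (p x) (last x + v)) *
     wave k v * f (x @ [last x + v]))"
| "correction k (Suc j) \<eta> x f = (\<Sum>v\<in>steps L. of_real (pmf (p \<eta>) (last x + v)) * wave k v *
     correction k j (\<eta> @ [last x + v]) (x @ [last x + v]) f)"

text \<open>
  The difference of two products telescopes over the index \<open>j\<close> of the factor which is switched from one
  history to the other.  From then on the walk has the shorter history.
\<close>
lemma char_from_telescope:
  "last \<eta> = last x \<Longrightarrow> char_from k n \<eta> = char_from k n x + (\<Sum>j<n. correction k j \<eta> x (char_from k (n - Suc j)))"
proof (induction n arbitrary: \<eta> x)
  case (Suc n)
  let ?P = "\<lambda>\<eta> v. complex_of_real (pmf (p \<eta>) (last x + v))"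
  let ?e = "\<lambda>v. [last x + v]"
  have IH: "char_from k n (\<eta> @ ?e v) = char_from k n (x @ ?e v) +
      (\<Sum>j<n. correction k j (\<eta> @ ?e v) (x @ ?e v) (char_from k (n - Suc j)))" for v
    by (rule Suc.IH) simp
  have "char_from k (Suc n) \<eta> = (\<Sum>v\<in>steps L. ?P \<eta> v * wave k v * char_from k n (\<eta> @ ?e v))"
    by (simp add: Suc.prems)
  also have "\<dots> = (\<Sum>v\<in>steps L. ?P x v * wave k v * char_from k n (x @ ?e v)
       + (?P \<eta> v - ?P x v) * wave k v * char_from k n (x @ ?e v)
       + (\<Sum>j<n. ?P \<eta> v * wave k v * correction k j (\<eta> @ ?e v) (x @ ?e v) (char_from k (n - Suc j))))"
    by (intro sum.cong refl, subst IH) (simp add: algebra_simps sum_distrib_left)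
  also have "\<dots> = char_from k (Suc n) x + correction k 0 \<eta> x (char_from k n) 
      + (\<Sum>j<n. correction k (Suc j) \<eta> x (char_from k (n - Suc j)))"
    by (simp add: sum.distrib sum.swap[of _ "steps L"])
  also have "\<dots> = char_from k (Suc n) x + (\<Sum>j<Suc n. correction k j \<eta> x (char_from k (Suc n - Suc j)))"
    by (subst sum.lessThan_Suc_shift) simp
  finally show ?case .
qed simp

lemma correction_sum:
  "correction k j \<eta> x (\<lambda>y. \<Sum>i\<in>I. f i y * c i) = (\<Sum>i\<in>I. correction k j \<eta> x (f i) * c i)"
proof (induction j arbitrary: \<eta> x)
  case 0
  show ?case
    by (simp add: sum_distrib_left sum_distrib_right sum.swap[of _ I] mult.assoc)
next
  case (Suc j)
  show ?case
    by (simp add: Suc.IH sum_distrib_left sum_distrib_right sum.swap[of _ I] mult.assoc)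
qed

text \<open>
  Each correction leaves a history that consists of the piece of path just summed over.  It serves as the long
  history of the next correction, against the history of the current vertex alone.
\<close>
primrec iterated_correction :: "real ^ 'd \<Rightarrow> nat list \<Rightarrow> (int ^ 'd) list \<Rightarrow> complex" where
  "iterated_correction k [] \<eta> = 1"
| "iterated_correction k (j # js) \<eta> = correction k j \<eta> [last \<eta>] (iterated_correction k js)"

end

text \<open>
  The number of steps consumed by the iterated correction with delays \<open>js\<close>, each delay \<open>j\<close> taking \<open>j + 1\<close>.
\<close>
definition step_count :: "nat list \<Rightarrow> nat" where
  "step_count js = sum_list js + length js"

lemma step_count_simps [simp]: "step_count [] = 0" "step_count (j # js) = Suc j + step_count js"
  by (auto simp: step_count_def)

lemma finite_step_count_le [simp]: "finite {js. step_count js \<le> n}"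
proof -
  have "set js \<subseteq> {..n} \<and> length js \<le> n" if "step_count js \<le> n" for js
    using that by (induction js) (auto simp: step_count_def)
  then have "{js. step_count js \<le> n} \<subseteq> {js. set js \<subseteq> {..n} \<and> length js \<le> n}" by auto
  then show ?thesis using finite_lists_length_le[of "{..n}" n] finite_subset by blast
qed

lemma sum_step_count_le:
  fixes g :: "_ \<Rightarrow> 'b::comm_monoid_add"
  shows "(\<Sum>js | step_count js \<le> n. g js) =
    g [] + (\<Sum>j<n. \<Sum>js | step_count js \<le> n - Suc j. g (j # js))"
proof -
  let ?h = "\<lambda>(j, js). j # js"
  let ?S = "Sigma {..<n} (\<lambda>j. {js. step_count js \<le> n - Suc j})"
  have eq: "{js. step_count js \<le> n} = insert [] (?h ` ?S)"
  proof (intro set_eqI iffI)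
    fix js assume "js \<in> {js. step_count js \<le> n}"
    then show "js \<in> insert [] (?h ` ?S)"
      by (cases js) (auto simp: image_iff)
  qed auto
  have "sum g (?h ` ?S) = (\<Sum>j<n. \<Sum>js | step_count js \<le> n - Suc j. g (j # js))"
    by (subst sum.reindex) (auto intro!: inj_onI simp: sum.Sigma case_prod_unfold)
  then show ?thesis unfolding eq by (subst sum.insert) auto
qed

context finite_range_law begin

text \<open>
  Iteration of the telescoping: the walk after each correction has fewer steps left, and the
  walk that forgets everything is, by translation invariance, the one started at \<open>0\<close>.
\<close>
lemma char_from_expansion:
  "char_from k n \<eta> = (\<Sum>js | step_count js \<le> n. iterated_correction k js \<eta> * char_from k (n - step_count js) [0])"
proof (induction n arbitrary: \<eta> rule: less_induct)
  case (less n)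
  have "char_from k n \<eta> = char_from k n [last \<eta>] + (\<Sum>j<n. correction k j \<eta> [last \<eta>] (char_from k (n - Suc j)))"
    by (rule char_from_telescope) simp
  also have "(\<Sum>j<n. correction k j \<eta> [last \<eta>] (char_from k (n - Suc j))) =
    (\<Sum>j<n. correction k j \<eta> [last \<eta>] (\<lambda>y. \<Sum>js | step_count js \<le> n - Suc j.
        iterated_correction k js y * char_from k (n - Suc j - step_count js) [0]))"
  proof (intro sum.cong refl)
    fix j assume "j \<in> {..<n}"
    then have "char_from k (n - Suc j) = (\<lambda>y. \<Sum>js | step_count js \<le> n - Suc j.
        iterated_correction k js y * char_from k (n - Suc j - step_count js) [0])"
      by (intro ext less.IH) auto
    then show "correction k j \<eta> [last \<eta>] (char_from k (n - Suc j)) = correction k j \<eta> [last \<eta>] (\<lambda>y. \<Sum>js | step_count js \<le> n - Suc j.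
        iterated_correction k js y * char_from k (n - Suc j - step_count js) [0])" by (rule arg_cong)
  qed
  also have "\<dots> = (\<Sum>j<n. \<Sum>js | step_count js \<le> n - Suc j. iterated_correction k (j # js) \<eta> * char_from k (n - step_count (j # js)) [0])"
    by (simp add: correction_sum)
  finally show ?case
    by (subst sum_step_count_le) (simp add: char_from_singleton[of k n "last \<eta>"])
qed

end

section \<open>The expansion coefficients as sums over chains of paths\<close>

text \<open>
  One factor of the product in the definition of the coefficients: the difference together with the
  transition probabilities that precede it.  The delay is read off from the length of the path.
\<close>
definition correction_weight :: "('d::finite) step_law \<Rightarrow> (int ^ 'd) list \<Rightarrow> (int ^ 'd) list \<Rightarrow> real" where
  "correction_weight p \<eta> xs = (let j = length xs - 2 in
     (pmf (p (path_concat \<eta> (take (j + 1) xs))) (xs ! (j + 1)) - pmf (p (take (j + 1) xs)) (xs ! (j + 1))) *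
     (\<Prod>i<j. pmf (p (path_concat \<eta> (take (i + 1) xs))) (xs ! (i + 1))))"

lemma correction_weight_Cons:
  assumes "length V = Suc j"
  shows "correction_weight p \<eta> (z # V) =
    (pmf (p (\<eta> @ take j V)) (V ! j) - pmf (p (z # take j V)) (V ! j)) *
    (\<Prod>i<j. pmf (p (\<eta> @ take i V)) (V ! i))"
  using assms by (simp add: correction_weight_def path_concat_def)

primrec chain_weight :: "('d::finite) step_law \<Rightarrow> (int ^ 'd) list \<Rightarrow> (int ^ 'd) list list \<Rightarrow> real" where
  "chain_weight p \<eta> [] = 1"
| "chain_weight p \<eta> (x # U) = correction_weight p \<eta> x * chain_weight p x U"

text \<open>
  The families of paths following \<open>\<eta>\<close> which can have nonzero weight.  Unlike \<open>linked\<close> below, they form a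
  finite set.
\<close>
primrec chains :: "real \<Rightarrow> nat list \<Rightarrow> (int ^ 'd::finite) list \<Rightarrow> (int ^ 'd) list list set" where
  "chains L [] \<eta> = {[]}"
| "chains L (j # js) \<eta> = (\<lambda>(V, U). (last \<eta> # V) # U) `
     Sigma (paths L (Suc j) (last \<eta>)) (\<lambda>V. chains L js (last \<eta> # V))"

lemma finite_chains [simp, intro]: "finite (chains L js \<eta>)"
  by (induction js arbitrary: \<eta>) auto

lemma sum_chains_Cons:
  fixes g :: "_ \<Rightarrow> 'b::comm_monoid_add"
  shows "(\<Sum>U\<in>chains L (j # js) \<eta>. g U) =
    (\<Sum>V\<in>paths L (Suc j) (last \<eta>). \<Sum>U\<in>chains L js (last \<eta> # V). g ((last \<eta> # V) # U))"
proof -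
  have "inj_on (\<lambda>(V, U). (last \<eta> # V) # U)
      (Sigma (paths L (Suc j) (last \<eta>)) (\<lambda>V. chains L js (last \<eta> # V)))"
    by (auto intro!: inj_onI)
  then show ?thesis
    by (simp add: sum.reindex sum.Sigma case_prod_unfold o_def del: paths.simps)
qed

text \<open>
  The condition of \<open>path_families\<close> on the paths of positive index, with \<open>\<eta>\<close> as the path of index \<open>0\<close>.
  Allowing arbitrary \<open>\<eta>\<close> makes it hereditary, as inductions over \<open>js\<close> need.
\<close>
definition linked :: "nat list \<Rightarrow> (int ^ 'd) list \<Rightarrow> (int ^ 'd) list list \<Rightarrow> bool" where
  "linked js \<eta> U \<longleftrightarrow> length U = length js \<and>
     (\<forall>n<length js. length (U ! n) = js ! n + 2 \<and> hd (U ! n) = last ((\<eta> # U) ! n))"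

lemma linked_Nil [simp]: "linked [] \<eta> U \<longleftrightarrow> U = []"
  by (auto simp: linked_def)

lemma linked_Cons [simp]:
  "linked (j # js) \<eta> (x # U) \<longleftrightarrow> length x = j + 2 \<and> hd x = last \<eta> \<and> linked js x U"
  by (auto simp: linked_def nth_Cons less_Suc_eq_0_disj split: nat.splits)

lemma linked_ConsE:
  assumes "linked (j # js) \<eta> W"
  obtains V U where "W = (last \<eta> # V) # U" "length V = Suc j" "linked js (last \<eta> # V) U"
proof -
  from assms obtain x U where W: "W = x # U" by (cases W) (auto simp: linked_def)
  with assms have x: "length x = j + 2" "hd x = last \<eta>" "linked js x U" by auto
  then obtain V where "x = last \<eta> # V" by (cases x) auto
  with W x that show ?thesis by auto
qed

lemma linked_chains: "U \<in> chains L js \<eta> \<Longrightarrow> linked js \<eta> U"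
  by (induction js arbitrary: \<eta> U) (auto simp del: paths.simps dest!: length_paths)

context finite_range_law begin

lemma correction_eq_sum_paths:
  "correction k j \<eta> x f = (\<Sum>V\<in>paths L (Suc j) (last x).
     of_real ((pmf (p (\<eta> @ take j V)) (V ! j) - pmf (p (x @ take j V)) (V ! j)) *
       (\<Prod>i<j. pmf (p (\<eta> @ take i V)) (V ! i))) *
     wave k (last V - last x) * f (x @ V))"
proof (induction j arbitrary: \<eta> x)
  case 0
  show ?case by (subst sum_paths_Suc) simp
next
  case (Suc j)
  show ?case
    unfolding correction.simps Suc.IH last_snoc
  proof (subst (2) sum_paths_Suc, intro sum.cong refl, subst sum_distrib_left, intro sum.cong refl)
    fix v V assume V: "V \<in> paths L (Suc j) (last x + v)"
    then have [simp]: "V \<noteq> []" using length_paths by fastforce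
    have "wave k (last V - last x) = wave k v * wave k (last V - (last x + v))"
      by (simp flip: wave_add)
    then show "complex_of_real (pmf (p \<eta>) (last x + v)) * wave k v *
      (complex_of_real
        ((pmf (p ((\<eta> @ [last x + v]) @ take j V)) (V ! j) -
          pmf (p ((x @ [last x + v]) @ take j V)) (V ! j)) *
         (\<Prod>i<j. pmf (p ((\<eta> @ [last x + v]) @ take i V)) (V ! i))) *
       wave k (last V - (last x + v)) * f ((x @ [last x + v]) @ V)) =
      complex_of_real
       ((pmf (p (\<eta> @ take (Suc j) ((last x + v) # V))) (((last x + v) # V) ! Suc j) -
         pmf (p (x @ take (Suc j) ((last x + v) # V))) (((last x + v) # V) ! Suc j)) *
        (\<Prod>i<Suc j. pmf (p (\<eta> @ take i ((last x + v) # V))) (((last x + v) # V) ! i))) *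
      wave k (last ((last x + v) # V) - last x) * f (x @ (last x + v) # V)"
      by (simp add: prod.lessThan_Suc_shift del: prod.lessThan_Suc)
  qed
qed

text \<open>
  The plane wave of the total displacement is the product of those of the individual pieces, so the
  iterated sums merge into one.
\<close>
lemma iterated_correction_eq_sum_chains:
  "iterated_correction k js \<eta> = (\<Sum>U\<in>chains L js \<eta>.
     of_real (chain_weight p \<eta> U) * wave k (last (last (\<eta> # U)) - last \<eta>))"
proof (induction js arbitrary: \<eta>)
  case (Cons j js)
  show ?case
    unfolding iterated_correction.simps correction_eq_sum_paths
  proof (subst sum_chains_Cons, unfold last_ConsL[OF refl], intro sum.cong refl)
    fix V assume V: "V \<in> paths L (Suc j) (last \<eta>)"
    then have lV: "length V = Suc j" by (rule length_paths)
    then have [simp]: "V \<noteq> []" by auto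
    have "wave k (last (last (\<eta> # (last \<eta> # V) # U)) - last \<eta>) =
        wave k (last V - last \<eta>) * wave k (last (last ((last \<eta> # V) # U)) - last V)" for U
      by (simp flip: wave_add)
    then show "complex_of_real
        ((pmf (p (\<eta> @ take j V)) (V ! j) - pmf (p ([last \<eta>] @ take j V)) (V ! j)) *
         (\<Prod>i<j. pmf (p (\<eta> @ take i V)) (V ! i))) *
       wave k (last V - last \<eta>) * iterated_correction k js ([last \<eta>] @ V) =
       (\<Sum>U\<in>chains L js (last \<eta> # V).
          complex_of_real (chain_weight p \<eta> ((last \<eta> # V) # U)) *
          wave k (last (last (\<eta> # (last \<eta> # V) # U)) - last \<eta>))"
      by (simp only: Cons.IH sum_distrib_left append_Cons append_Nil, intro sum.cong refl)
         (simp add: correction_weight_Cons[OF lV] mult_ac)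
  qed
qed simp

text \<open>
  A step that is too long either makes one of the preceding transition probabilities vanish, or
  it is the last step, where both terms of the difference vanish.
\<close>
lemma correction_weight_eq_0:
  assumes "\<eta> \<noteq> []" "length V = Suc j" "V \<notin> paths L (Suc j) (last \<eta>)"
  shows "correction_weight p \<eta> (last \<eta> # V) = 0"
proof -
  from not_in_paths[OF assms(2,3)] obtain i where
    i: "i < Suc j" "V ! i - (last \<eta> # V) ! i \<notin> steps L" by auto
  have zero: "pmf (p (\<zeta> @ take i V)) (V ! i) = 0" if "\<zeta> \<noteq> []" "last \<zeta> = last \<eta>" for \<zeta>
    using that i assms(2) last_append_take[of i V \<zeta> "last \<eta>"] by (intro pmf_zero) auto
  show ?thesis
  proof (cases "i = j")
    case True
    then show ?thesis
      using zero[of \<eta>] zero[of "[last \<eta>]"] assms by (simp add: correction_weight_Cons[OF assms(2)])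
  next
    case False
    with i have "\<exists>i\<in>{..<j}. pmf (p (\<eta> @ take i V)) (V ! i) = 0"
      using zero[of \<eta>] assms(1) by (intro bexI[of _ i]) auto
    then show ?thesis by (simp add: correction_weight_Cons[OF assms(2)])
  qed
qed

lemma chain_weight_eq_0:
  "\<eta> \<noteq> [] \<Longrightarrow> linked js \<eta> W \<Longrightarrow> W \<notin> chains L js \<eta> \<Longrightarrow> chain_weight p \<eta> W = 0"
proof (induction js arbitrary: \<eta> W)
  case (Cons j js)
  from Cons.prems(2) obtain V U where W: "W = (last \<eta> # V) # U" "length V = Suc j"
    "linked js (last \<eta> # V) U" by (rule linked_ConsE)
  show ?case
  proof (cases "V \<in> paths L (Suc j) (last \<eta>)")
    case True
    then have "U \<notin> chains L js (last \<eta> # V)"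
      using Cons.prems(3) unfolding W chains.simps by force
    then show ?thesis using Cons.IH[of "last \<eta> # V" U] W by simp
  next
    case False
    then show ?thesis using correction_weight_eq_0[OF Cons.prems(1) W(2)] W(1) by simp
  qed
qed simp

end

lemma path_families_eq:
  "path_families js = {[0, y] # U | y U. linked js [0, y] U}"
proof (intro set_eqI iffI)
  fix W :: "(int ^ 'd) list list" assume "W \<in> path_families js"
  then have W: "length W = length js + 1" "\<And>n. n \<le> length js \<Longrightarrow> length (W ! n) = (0 # js) ! n + 2"
    "hd (W ! 0) = 0" "\<And>n. n \<in> {1..length js} \<Longrightarrow> hd (W ! n) = last (W ! (n - 1))"
    by (auto simp: path_families_def)
  from W(1) obtain x U where xU: "W = x # U" by (cases W) auto
  from W(2)[of 0] W(3) obtain y where x: "x = [0, y]"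
    by (auto simp: xU length_Suc_conv numeral_2_eq_2)
  have "linked js x U"
    unfolding linked_def using W(1) W(2)[of "Suc _"] W(4)[of "Suc _"] by (auto simp: xU)
  then show "W \<in> {[0, y] # U | y U. linked js [0, y] U}" by (auto simp: xU x)
next
  fix W :: "(int ^ 'd) list list" assume "W \<in> {[0, y] # U | y U. linked js [0, y] U}"
  then obtain y U where W: "W = [0, y] # U" and U: "linked js [0, y] U" by auto
  have "length (W ! n) = (0 # js) ! n + 2" if "n \<le> length js" for n
    using that U unfolding W linked_def by (cases n) auto
  moreover have "hd (W ! n) = last (W ! (n - 1))" if "n \<in> {1..length js}" for n
    using that U unfolding W linked_def by (cases n) auto
  ultimately show "W \<in> path_families js"
    using U unfolding path_families_def by (auto simp: W linked_def)
qed

lemma prod_Delta_eq_chain_weight: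
  assumes "linked js \<eta> U" 
  shows "(\<Prod>n=1..length js. Delta p js (\<eta> # U) n *
           (\<Prod>i<(0 # js) ! n.
              pmf (p (path_concat ((\<eta> # U) ! (n - 1)) (take (i + 1) ((\<eta> # U) ! n)))) (((\<eta> # U) ! n) ! (i + 1))))
     = chain_weight p \<eta> U"
proof -
  have "chain_weight p \<eta> U = (\<Prod>n=1..length js. correction_weight p ((\<eta> # U) ! (n - 1)) ((\<eta> # U) ! n))"
    using assms
  proof (induction js arbitrary: \<eta> U)
    case (Cons j js)
    then obtain x U' where "U = x # U'" by (cases U) (auto simp: linked_def)
    with Cons.prems have U: "U = x # U'" "linked js x U'" by auto
    have "(\<Prod>n=1..length (j # js). correction_weight p ((\<eta> # U) ! (n - 1)) ((\<eta> # U) ! n))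
      = correction_weight p \<eta> x * (\<Prod>n=1..length js. correction_weight p ((\<eta> # U) ! n) ((\<eta> # U) ! Suc n))"
      by (subst prod.atLeast_Suc_atMost)
         (simp_all add: U(1) prod.shift_bounds_cl_Suc_ivl del: prod.cl_ivl_Suc)
    also have "(\<Prod>n=1..length js. correction_weight p ((\<eta> # U) ! n) ((\<eta> # U) ! Suc n)) =
      (\<Prod>n=1..length js. correction_weight p ((x # U') ! (n - 1)) ((x # U') ! n))"
      by (intro prod.cong) (auto simp: U(1) nth_Cons split: nat.splits)
    finally show ?case using Cons.IH[OF U(2)] U(1) by simp
  qed simp
  also have "\<dots> = (\<Prod>n=1..length js. Delta p js (\<eta> # U) n *
           (\<Prod>i<(0 # js) ! n.
              pmf (p (path_concat ((\<eta> # U) ! (n - 1)) (take (i + 1) ((\<eta> # U) ! n)))) (((\<eta> # U) ! n) ! (i + 1))))"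
  proof (intro prod.cong refl)
    fix n assume "n \<in> {1..length js}"
    then have "length ((\<eta> # U) ! n) - 2 = (0 # js) ! n"
      using assms unfolding linked_def by (cases n) auto
    then show "correction_weight p ((\<eta> # U) ! (n - 1)) ((\<eta> # U) ! n) = Delta p js (\<eta> # U) n *
           (\<Prod>i<(0 # js) ! n.
              pmf (p (path_concat ((\<eta> # U) ! (n - 1)) (take (i + 1) ((\<eta> # U) ! n)))) (((\<eta> # U) ! n) ! (i + 1)))"
      by (simp add: correction_weight_def Delta_def Let_def)
  qed
  finally show ?thesis ..
qed

lemma wave_has_vector_derivative:
  "((\<lambda>t. wave (k + t *\<^sub>R h) x) has_vector_derivative
     \<i> * of_real (h \<bullet> rvec x) * wave (k + t *\<^sub>R h) x) (at t within S)"
proof -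
  have eq: "(\<lambda>t. wave (k + t *\<^sub>R h) x) =
    (\<lambda>t. (\<lambda>z. exp (\<i> * (of_real (k \<bullet> rvec x) + z * of_real (h \<bullet> rvec x)))) (of_real t))"
    by (auto simp: wave_def inner_add_left)
  show ?thesis unfolding eq
    by (rule has_vector_derivative_real_field)
       (auto intro!: derivative_eq_intros simp: wave_def inner_add_left)
qed

lemma wave_sum_has_vector_derivative:
  "((\<lambda>t. \<Sum>a\<in>A. of_real (c a) * wave (k + t *\<^sub>R h) (x a)) has_vector_derivative
     (\<Sum>a\<in>A. of_real (c a) * (\<i> * of_real (h \<bullet> rvec (x a)) * wave (k + t *\<^sub>R h) (x a)))) (at t within S)"
  by (intro has_vector_derivative_sum has_vector_derivative_mult_right wave_has_vector_derivative)

lemma gradient_wave_sum: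
  "gradient (\<lambda>k. \<Sum>a\<in>A. of_real (c a) * wave k (x a)) 0 = \<i> *s cvec (\<Sum>a\<in>A. c a *\<^sub>R rvec (x a))"
proof -
  have "partial_deriv b (\<lambda>k. \<Sum>a\<in>A. of_real (c a) * wave k (x a)) 0 =
      (\<Sum>a\<in>A. of_real (c a) * (\<i> * of_real (rvec (x a) $ b)))" for b
    unfolding partial_deriv_def
    by (rule vector_derivative_at)
       (use wave_sum_has_vector_derivative[where A = A and c = c and k = 0 and h = "axis b 1" and x = x and t = 0 and S = UNIV] in \<open>simp add: inner_axis'\<close>)
  then show ?thesis
    by (simp add: gradient_def vec_eq_iff cvec_def sum_distrib_left mult_ac)
qed

text \<open>The endpoint at which the coefficients are evaluated is the last vertex of the last path.\<close>
lemma linked_last_vertex: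
  assumes "linked js \<eta> U" "length \<eta> = 2"
  shows "((\<eta> # U) ! length js) ! ((0 # js) ! length js + 1) = last (last (\<eta> # U))"
proof -
  have "last (\<eta> # U) = (\<eta> # U) ! length js"
    using assms by (cases "js = []") (auto simp: last_conv_nth linked_def nth_Cons')
  moreover have "length ((\<eta> # U) ! length js) = (0 # js) ! length js + 2"
    using assms by (cases "length js") (auto simp: linked_def)
  ultimately show ?thesis
    by (cases "(\<eta> # U) ! length js = []") (simp_all add: last_conv_nth)
qed

lemma infsum_times_point_masses:
  fixes e :: "'x \<Rightarrow> complex"
  assumes "finite A"
  shows "(\<Sum>\<^sub>\<infinity>x. e x * of_real (\<Sum>a\<in>A. (if h a = x then 1 else 0) * c a)) = (\<Sum>a\<in>A. of_real (c a) * e (h a))"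
proof -
  have "(\<Sum>\<^sub>\<infinity>x. e x * of_real (\<Sum>a\<in>A. (if h a = x then 1 else 0) * c a)) =
      (\<Sum>\<^sub>\<infinity>x\<in>h ` A. e x * of_real (\<Sum>a\<in>A. (if h a = x then 1 else 0) * c a))"
    by (intro infsum_cong_neutral) (auto intro!: sum.neutral)
  also have "\<dots> = (\<Sum>x\<in>h ` A. \<Sum>a\<in>A. if h a = x then of_real (c a) * e (h a) else 0)"
    using assms by (auto intro!: sum.cong simp: sum_distrib_left)
  also have "\<dots> = (\<Sum>a\<in>A. \<Sum>x\<in>h ` A. if h a = x then of_real (c a) * e (h a) else 0)"
    by (rule sum.swap)
  also have "\<dots> = (\<Sum>a\<in>A. of_real (c a) * e (h a))"
    using assms by (intro sum.cong) auto
  finally show ?thesis .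
qed

text \<open>
  All index lists of the coefficient of order \<open>m\<close>, for every number \<open>N\<close> of pieces together.  The
  first step of the walk accounts for the summand \<open>1\<close>.
\<close>
definition coeff_index :: "nat \<Rightarrow> nat list set" where
  "coeff_index m = {js. js \<noteq> [] \<and> step_count js + 1 = m}"

lemma finite_coeff_index [simp]: "finite (coeff_index m)"
  by (rule finite_subset[OF _ finite_step_count_le[of m]]) (auto simp: coeff_index_def)

lemma expansion_index_eq: "expansion_index m N = {js. length js = N \<and> step_count js + 1 = m}"
  by (auto simp: expansion_index_def step_count_def)

context finite_range_law begin

definition start_chains :: "nat list \<Rightarrow> (int ^ 'd) list list set" where
  "start_chains js = (\<lambda>(v, U). [0, v] # U) ` Sigma (steps L) (\<lambda>v. chains L js [0, v])"

definition start_weight :: "(int ^ 'd) list list \<Rightarrow> real" where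
  "start_weight W = first_step p (W ! 0 ! 1) * chain_weight p (hd W) (tl W)"

lemma finite_start_chains [simp]: "finite (start_chains js)"
  by (auto simp: start_chains_def)

lemma sum_start_chains:
  fixes g :: "_ \<Rightarrow> 'b::comm_monoid_add"
  shows "(\<Sum>W\<in>start_chains js. g W) = (\<Sum>v\<in>steps L. \<Sum>U\<in>chains L js [0, v]. g ([0, v] # U))"
proof -
  have "inj_on (\<lambda>(v, U). [0, v] # U) (Sigma (steps L :: (int ^ 'd) set) (\<lambda>v. chains L js [0, v]))"
    by (auto intro!: inj_onI)
  then show ?thesis
    unfolding start_chains_def
    by (simp add: sum.reindex sum.Sigma case_prod_unfold o_def)
qed

lemma first_step_eq_0: "y \<notin> steps L \<Longrightarrow> first_step p y = 0"
  using pmf_zero[of "[0]" y] by (simp add: first_step_def)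

text \<open>
  The infinite sum over all path families reduces to a finite one, since a family with a step out of
  range has weight zero.
\<close>
lemma pi_coeff_N_eq:
  "pi_coeff_N p m N y = (\<Sum>js\<in>expansion_index m N. \<Sum>W\<in>start_chains js.
     (if last (last W) = y then 1 else 0) * start_weight W)"
  unfolding pi_coeff_N_def
proof (intro sum.cong refl)
  fix js assume "js \<in> expansion_index m N"
  then have N: "N = length js" by (simp add: expansion_index_def)
  let ?t = "\<lambda>W. (if (W ! N) ! ((0 # js) ! N + 1) = y then 1 else 0) *
        first_step p ((W ! 0) ! 1) *
        (\<Prod>n=1..N. Delta p js W n *
           (\<Prod>i<(0 # js) ! n.
              pmf (p (path_concat (W ! (n - 1)) (take (i + 1) (W ! n)))) ((W ! n) ! (i + 1))))"
  have t: "?t ([0, v] # U) = (if last (last ([0, v] # U)) = y then 1 else 0) * start_weight ([0, v] # U)"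
    if "linked js [0, v] U" for v U
    unfolding N prod_Delta_eq_chain_weight[OF that]
    by (subst linked_last_vertex[OF that]) (simp_all add: start_weight_def)
  have "infsum ?t (path_families js) = infsum (\<lambda>W. (if last (last W) = y then 1 else 0) * start_weight W) (start_chains js)"
  proof (rule infsum_cong_neutral)
    fix W assume "W \<in> start_chains js - path_families js"
    then show "(if last (last W) = y then 1 else 0) * start_weight W = 0"
      unfolding start_chains_def path_families_eq by (auto dest: linked_chains)
  next
    fix W assume W: "W \<in> path_families js - start_chains js"
    then obtain v U where vU: "W = [0, v] # U" "linked js [0, v] U" by (auto simp: path_families_eq)
    have "start_weight W = 0"
    proof (cases "v \<in> steps L")
      case True
      with W vU have "U \<notin> chains L js [0, v]" by (auto simp: start_chains_def)
      with vU chain_weight_eq_0[of "[0, v]" js U] show ?thesis by (simp add: start_weight_def)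
    next
      case False
      with vU show ?thesis by (simp add: start_weight_def first_step_eq_0)
    qed
    then show "?t W = 0" using t[OF vU(2)] vU(1) by simp
  next
    fix W assume "W \<in> path_families js \<inter> start_chains js"
    then obtain v U where vU: "W = [0, v] # U" "linked js [0, v] U" by (auto simp: path_families_eq)
    show "?t W = (if last (last W) = y then 1 else 0) * start_weight W" using t[OF vU(2)] vU(1) by simp
  qed
  then show "infsum ?t (path_families js) = (\<Sum>W\<in>start_chains js. (if last (last W) = y then 1 else 0) * start_weight W)"
    by simp
qed

definition coeff_terms :: "nat \<Rightarrow> (nat list \<times> (int ^ 'd) list list) set" where
  "coeff_terms m = Sigma (coeff_index m) start_chains"

lemma finite_coeff_terms [simp]: "finite (coeff_terms m)"
  by (auto simp: coeff_terms_def)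

lemma pi_coeff_eq:
  "pi_coeff p m y = (\<Sum>(js, W)\<in>coeff_terms m. (if last (last W) = y then 1 else 0) * start_weight W)"
proof -
  have "pi_coeff p m y = (\<Sum>N<m. pi_coeff_N p m (N + 1) y)"
    unfolding pi_coeff_def
  proof (rule suminf_finite)
    fix N assume "N \<notin> {..<m}"
    then have "expansion_index m (N + 1) = {}" by (auto simp: expansion_index_def)
    then show "pi_coeff_N p m (N + 1) y = 0" by (simp add: pi_coeff_N_def)
  qed auto
  also have "\<dots> = (\<Sum>N<m. \<Sum>js\<in>expansion_index m (N + 1). \<Sum>W\<in>start_chains js.
     (if last (last W) = y then 1 else 0) * start_weight W)"
    by (simp only: pi_coeff_N_eq)
  also have "\<dots> = (\<Sum>js\<in>(\<Union>N\<in>{..<m}. expansion_index m (N + 1)). \<Sum>W\<in>start_chains js.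
     (if last (last W) = y then 1 else 0) * start_weight W)"
  proof (rule sum.UNION_disjoint[symmetric])
    show "\<forall>N\<in>{..<m}. finite (expansion_index m (N + 1))"
      by (intro ballI finite_subset[OF _ finite_coeff_index[of m]]) (auto simp: expansion_index_eq coeff_index_def)
  qed (auto simp: expansion_index_def)
  also have "(\<Union>N\<in>{..<m}. expansion_index m (N + 1)) = coeff_index m"
  proof (intro set_eqI iffI)
    fix js assume "js \<in> coeff_index m"
    then show "js \<in> (\<Union>N\<in>{..<m}. expansion_index m (N + 1))"
      by (intro UN_I[of "length js - 1"]) (auto simp: coeff_index_def expansion_index_eq step_count_def Suc_le_eq)
  qed (auto simp: expansion_index_eq coeff_index_def)
  finally show ?thesis by (simp add: coeff_terms_def sum.Sigma)
qed

lemma pi_hat_eq: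
  "pi_hat p m k = (\<Sum>w\<in>coeff_terms m. of_real (start_weight (snd w)) * wave k (last (last (snd w))))"
  unfolding pi_hat_def pi_coeff_eq wave_def[symmetric] case_prod_unfold
  by (rule infsum_times_point_masses) simp

text \<open>The first moment of the coefficient of order \<open>m\<close>.  Its Fourier transform has gradient \<open>\<i>\<close> times this vector at \<open>0\<close>.\<close>
definition drift :: "nat \<Rightarrow> real ^ 'd" where
  "drift m = (\<Sum>w\<in>coeff_terms m. start_weight (snd w) *\<^sub>R rvec (last (last (snd w))))"

lemma pi_hat_has_vector_derivative:
  "((\<lambda>t. pi_hat p m (t *\<^sub>R h)) has_vector_derivative \<i> * of_real (h \<bullet> drift m)) (at 0)"
  using wave_sum_has_vector_derivative[where A = "coeff_terms m" and c = "\<lambda>w. start_weight (snd w)" and k = 0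
    and h = h and x = "\<lambda>w. last (last (snd w))" and t = 0 and S = UNIV]
  by (simp add: pi_hat_eq drift_def inner_sum_right sum_distrib_left mult_ac)

lemma gradient_pi_hat: "gradient (pi_hat p m) 0 = \<i> *s cvec (drift m)"
  unfolding pi_hat_eq[abs_def] drift_def by (rule gradient_wave_sum)

lemma pi_hat_eq_iterated_correction:
  "pi_hat p m k = (\<Sum>js\<in>coeff_index m. \<Sum>v\<in>steps L. of_real (first_step p v) * wave k v * iterated_correction k js [0, v])"
proof -
  have "pi_hat p m k = (\<Sum>js\<in>coeff_index m. \<Sum>W\<in>start_chains js.
      of_real (start_weight W) * wave k (last (last W)))"
    by (simp add: pi_hat_eq coeff_terms_def sum.Sigma case_prod_unfold)
  also have "\<dots> = (\<Sum>js\<in>coeff_index m. \<Sum>v\<in>steps L. of_real (first_step p v) * wave k v * iterated_correction k js [0, v])"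
  proof (intro sum.cong refl, subst sum_start_chains, intro sum.cong refl)
    fix js v
    have "wave k (last (last ([0, v] # U))) = wave k v * wave k (last (last ([0, v] # U)) - v)" for U
      by (simp flip: wave_add)
    then show "(\<Sum>U\<in>chains L js [0, v]. of_real (start_weight ([0, v] # U)) * wave k (last (last ([0, v] # U)))) =
        of_real (first_step p v) * wave k v * iterated_correction k js [0, v]"
      by (simp only: iterated_correction_eq_sum_chains sum_distrib_left, intro sum.cong refl)
         (simp add: start_weight_def mult_ac)
  qed
  finally show ?thesis .
qed

definition step_hat :: "real ^ 'd \<Rightarrow> complex" where
  "step_hat k = (\<Sum>v\<in>steps L. of_real (first_step p v) * wave k v)"

text \<open>
  Split off the first step, expand what follows it, and group the terms by the time \<open>m\<close> at
  which the last correction ends.  The empty list of delays gives the term in which the first step is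
  forgotten.
\<close>
lemma char_recursion:
  "char_from k (Suc n) [0] = step_hat k * char_from k n [0] + (\<Sum>m=2..Suc n. pi_hat p m k * char_from k (Suc n - m) [0])"
proof -
  define H where "H js = (\<Sum>v\<in>steps L. of_real (first_step p v) * wave k v * iterated_correction k js [0, v])" for js
  let ?J = "{js. step_count js \<le> n}"
  have "char_from k (Suc n) [0] = (\<Sum>v\<in>steps L. of_real (first_step p v) * wave k v * char_from k n [0, v])"
    by (simp add: first_step_def)
  also have "\<dots> = (\<Sum>v\<in>steps L. \<Sum>js\<in>?J. 
      of_real (first_step p v) * wave k v * iterated_correction k js [0, v] * char_from k (n - step_count js) [0])"
    by (subst char_from_expansion) (simp add: sum_distrib_left mult.assoc)
  also have "\<dots> = (\<Sum>js\<in>?J. H js * char_from k (n - step_count js) [0])"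
    by (subst sum.swap) (simp add: H_def sum_distrib_right)
  also have "\<dots> = H [] * char_from k n [0] + (\<Sum>js\<in>?J - {[]}. H js * char_from k (n - step_count js) [0])"
    by (subst sum.remove[of _ "[]"]) auto
  also have "H [] = step_hat k" by (simp add: H_def step_hat_def)
  also have "(\<Sum>js\<in>?J - {[]}. H js * char_from k (n - step_count js) [0]) =
     (\<Sum>m=2..Suc n. \<Sum>js\<in>{js\<in>?J - {[]}. step_count js + 1 = m}. H js * char_from k (n - step_count js) [0])"
  proof (rule sum.group[symmetric])
    show "(\<lambda>js. step_count js + 1) ` (?J - {[]}) \<subseteq> {2..Suc n}"
    proof (intro image_subsetI)
      fix js assume "js \<in> ?J - {[]}"
      then show "step_count js + 1 \<in> {2..Suc n}" by (cases js) auto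
    qed
  qed auto
  also have "\<dots> = (\<Sum>m=2..Suc n. pi_hat p m k * char_from k (Suc n - m) [0])"
  proof (intro sum.cong refl)
    fix m assume m: "m \<in> {2..Suc n}"
    then have eq: "{js\<in>?J - {[]}. step_count js + 1 = m} = coeff_index m"
      by (auto simp: coeff_index_def)
    have "n - step_count js = Suc n - m" if "js \<in> coeff_index m" for js
      using that by (auto simp: coeff_index_def)
    then show "(\<Sum>js\<in>{js\<in>?J - {[]}. step_count js + 1 = m}. H js * char_from k (n - step_count js) [0])
        = pi_hat p m k * char_from k (Suc n - m) [0]"
      unfolding pi_hat_eq_iterated_correction H_def[symmetric] sum_distrib_right eq
      by (intro sum.cong refl) simp
  qed
  finally show ?thesis .
qed

section \<open>The law of the walk\<close>

definition path_prob :: "(int ^ 'd) list \<Rightarrow> (int ^ 'd) list \<Rightarrow> real" where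
  "path_prob \<eta> V = (\<Prod>i<length V. pmf (p (\<eta> @ take i V)) (V ! i))"

lemma char_from_eq_sum_paths:
  "char_from k n \<eta> = (\<Sum>V\<in>paths L n (last \<eta>). of_real (path_prob \<eta> V) * wave k (last (last \<eta> # V) - last \<eta>))"
proof (induction n arbitrary: \<eta>)
  case 0
  show ?case by (simp add: path_prob_def)
next
  case (Suc n)
  have "wave k (last (z # y # V) - z) = wave k (y - z) * wave k (last (y # V) - y)" for y z :: "int ^ 'd" and V
    by (simp flip: wave_add)
  moreover have "path_prob \<eta> (y # V) = pmf (p \<eta>) y * path_prob (\<eta> @ [y]) V" for y V
    by (simp add: path_prob_def prod.lessThan_Suc_shift del: prod.lessThan_Suc)
  ultimately show ?case
    by (subst sum_paths_Suc) (simp add: Suc.IH sum_distrib_left mult_ac del: last.simps)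
qed

lemma char_from_0: "\<eta> \<noteq> [] \<Longrightarrow> char_from 0 n \<eta> = 1"
proof (induction n arbitrary: \<eta>)
  case (Suc n)
  then show ?case
    using sum_pmf_steps[OF Suc.prems] by (simp flip: of_real_sum)
qed simp

lemma path_prob_nonneg: "path_prob \<eta> V \<ge> 0"
  by (auto simp: path_prob_def intro: prod_nonneg)

lemma sum_path_prob: "(\<Sum>V\<in>paths L n 0. path_prob [0] V) = 1"
proof -
  have "complex_of_real (\<Sum>V\<in>paths L n 0. path_prob [0] V) = 1"
    using char_from_eq_sum_paths[of 0 n "[0]"] char_from_0[of "[0]" n] by simp
  then show ?thesis by (simp only: of_real_eq_1_iff)
qed

text \<open>
  The finitely many cylinder sets over the paths of \<open>n\<close> admissible steps are disjoint with total
  probability one, so that almost surely exactly one of them occurs.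
\<close>
lemma integral_position:
  fixes f :: "int ^ 'd \<Rightarrow> 'b::{banach, second_countable_topology}"
  assumes Q: "is_walk_law p Q"
  shows "(\<integral>\<omega>. f (\<omega> n) \<partial>Q) = (\<Sum>V\<in>paths L n 0. path_prob [0] V *\<^sub>R f (last (0 # V)))"
proof -
  interpret prob_space Q using Q by (simp add: is_walk_law_def)
  let ?M = "\<Pi>\<^sub>M i\<in>(UNIV :: nat set). count_space (UNIV :: (int ^ 'd) set)"
  have sets [measurable_cong]: "sets Q = sets ?M" using Q by (simp add: is_walk_law_def)
  have comp [measurable]: "(\<lambda>\<omega>. \<omega> i) \<in> measurable Q (count_space UNIV)" for i
    by measurable
  define cyl where "cyl V = {\<omega> \<in> space Q. \<forall>i\<le>n. \<omega> i = (0 # V) ! i}" for V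
  have cyl_sets [measurable]: "cyl V \<in> sets Q" for V
    unfolding cyl_def by measurable
  have prob_cyl: "prob (cyl V) = path_prob [0] V" if "V \<in> paths L n 0" for V
    using Q length_paths[OF that] unfolding is_walk_law_def cyl_def path_prob_def
    by (auto dest!: spec[of _ n] spec[of _ "0 # V"])
  have cyl_unique: "V = V'" if "\<omega> \<in> cyl V" "\<omega> \<in> cyl V'" "V \<in> paths L n 0" "V' \<in> paths L n 0" for \<omega> V V'
  proof (rule nth_equalityI)
    fix i assume "i < length V"
    then show "V ! i = V' ! i"
      using that length_paths[OF that(3)] unfolding cyl_def by (auto dest!: spec[of _ "Suc i"])
  qed (use length_paths[OF that(3)] length_paths[OF that(4)] in simp)
  have "prob (\<Union>V\<in>paths L n 0. cyl V) = (\<Sum>V\<in>paths L n 0. prob (cyl V))"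
    by (intro finite_measure_finite_Union) (auto simp: disjoint_family_on_def dest: cyl_unique)
  then have "prob (\<Union>V\<in>paths L n 0. cyl V) = 1"
    using prob_cyl sum_path_prob by simp
  then have "AE \<omega> in Q. \<omega> \<in> (\<Union>V\<in>paths L n 0. cyl V)"
    by (intro AE_prob_1)
  then have "AE \<omega> in Q. f (\<omega> n) = (\<Sum>V\<in>paths L n 0. indicator (cyl V) \<omega> *\<^sub>R f (last (0 # V)))"
  proof eventually_elim
    case (elim \<omega>)
    then obtain V where V: "V \<in> paths L n 0" "\<omega> \<in> cyl V" by auto
    have "(\<Sum>V\<in>paths L n 0. indicator (cyl V) \<omega> *\<^sub>R f (last (0 # V))) = 
        (\<Sum>V'\<in>paths L n 0. if V' = V then f (last (0 # V)) else 0)"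
      using V cyl_unique by (intro sum.cong refl) (auto simp: indicator_def)
    also have "\<dots> = f (last (0 # V))" using V by simp
    also have "last (0 # V) = \<omega> n"
      using V length_paths[OF V(1)] by (auto simp: cyl_def last_conv_nth nth_Cons')
    finally show ?case ..
  qed
  then have "(\<integral>\<omega>. f (\<omega> n) \<partial>Q) = (\<integral>\<omega>. (\<Sum>V\<in>paths L n 0. indicator (cyl V) \<omega> *\<^sub>R f (last (0 # V))) \<partial>Q)"
    by (intro integral_cong_AE) (measurable)
  also have "\<dots> = (\<Sum>V\<in>paths L n 0. prob (cyl V) *\<^sub>R f (last (0 # V)))"
    by (subst Bochner_Integration.integral_sum) (auto simp: less_top[symmetric])
  finally show ?thesis using prob_cyl by simp
qed

end

section \<open>Tails and truncated moments of the bounding sequence\<close>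

definition tail_sum :: "(nat \<Rightarrow> real) \<Rightarrow> nat \<Rightarrow> real" where
  "tail_sum b n = (\<Sum>i. b (i + n + 1))"

locale bound_sequence =
  fixes b :: "nat \<Rightarrow> real"
  assumes b_one: "b 1 \<ge> 1" and b_nonneg: "\<And>m. m \<ge> 1 \<Longrightarrow> b m \<ge> 0"
    and b_summable: "summable (\<lambda>m. b (m + 1))"
begin

abbreviation moment_sum :: "nat \<Rightarrow> real" where "moment_sum n \<equiv> \<Sum>m=1..n. real m * b m"

lemma summable_tail: "summable (\<lambda>i. b (i + n + 1))"
  using summable_ignore_initial_segment[OF b_summable, of n] by simp

lemma tail_sum_Suc: "tail_sum b n = b (n + 1) + tail_sum b (Suc n)"
  using suminf_split_head[OF summable_tail[of n]] by (simp add: tail_sum_def add_ac)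

lemma tail_sum_nonneg: "tail_sum b n \<ge> 0"
  unfolding tail_sum_def by (intro suminf_nonneg summable_tail b_nonneg) simp

lemma tail_sum_Suc_le: "tail_sum b (Suc n) \<le> tail_sum b n"
  using tail_sum_Suc[of n] b_nonneg[of "n + 1"] by simp

lemma tail_sum_le_0: "tail_sum b n \<le> tail_sum b 0"
  by (induction n) (auto intro: order_trans[OF tail_sum_Suc_le])

lemma sum_b_le: "(\<Sum>m=2..n. b m) \<le> tail_sum b 0"
proof -
  have "(\<Sum>m=2..n. b m) \<le> (\<Sum>m=1..n. b m)"
    by (rule sum_mono2) (auto intro: b_nonneg)
  also have "\<dots> = (\<Sum>i<n. b (i + 1))"
    by (rule sum.reindex_bij_witness[of _ Suc "\<lambda>m. m - 1"]) auto
  also have "\<dots> \<le> tail_sum b 0"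
    using sum_le_suminf[OF b_summable, of "{..<n}"] b_nonneg by (simp add: tail_sum_def)
  finally show ?thesis .
qed

lemma summable_truncated: "summable (\<lambda>m. real (min n (m + 1)) * b (m + 1))"
  by (rule summable_comparison_test[OF _ summable_mult[OF b_summable, of "real n"]])
     (auto intro!: exI[of _ 0] mult_right_mono simp: abs_mult b_nonneg)

lemma truncated_mass_Suc: "truncated_mass b (Suc n) = truncated_mass b n + tail_sum b n"
proof -
  let ?d = "\<lambda>m. if m < n then 0 else b (m + 1)"
  have eq: "real (min (Suc n) (m + 1)) * b (m + 1) - real (min n (m + 1)) * b (m + 1) = ?d m" for m
  proof (cases "m < n")
    case True
    then have "min (Suc n) (m + 1) = m + 1" "min n (m + 1) = m + 1" by auto
    with True show ?thesis by simp
  qed (auto simp: min_def algebra_simps)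
  have "truncated_mass b (Suc n) - truncated_mass b n = (\<Sum>m. ?d m)"
    unfolding truncated_mass_def
    by (subst suminf_diff[OF summable_truncated summable_truncated]) (simp only: eq)
  also have "summable ?d"
    using summable_diff[OF summable_truncated[of "Suc n"] summable_truncated[of n]] unfolding eq .
  then have "(\<Sum>m. ?d m) = (\<Sum>m. ?d (m + n)) + (\<Sum>m<n. ?d m)"
    by (rule suminf_split_initial_segment)
  also have "\<dots> = tail_sum b n" by (simp add: tail_sum_def)
  finally show ?thesis by simp
qed

text \<open>
  Both sides count \<open>b m\<close> once for every \<open>j < n\<close> with \<open>j < m\<close>.
\<close>
lemma truncated_mass_eq_sum_tail: "truncated_mass b n = (\<Sum>j<n. tail_sum b j)"
  by (induction n) (simp_all add: truncated_mass_Suc, simp add: truncated_mass_def)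

lemma truncated_mass_eq: "truncated_mass b n = moment_sum n + real n * tail_sum b n"
proof (induction n)
  case (Suc n)
  have "truncated_mass b (Suc n) = moment_sum n + real n * tail_sum b n + tail_sum b n"
    by (simp add: truncated_mass_Suc Suc.IH)
  also have "\<dots> = moment_sum n + real (Suc n) * (b (n + 1) + tail_sum b (Suc n))"
    by (subst tail_sum_Suc[symmetric]) (simp add: algebra_simps)
  finally show ?case by (simp add: algebra_simps)
qed (simp add: truncated_mass_def)

lemma truncated_mass_ge_1: "n \<ge> 1 \<Longrightarrow> truncated_mass b n \<ge> 1"
proof (induction n)
  case (Suc n)
  show ?case
  proof (cases n)
    case 0
    then show ?thesis using tail_sum_Suc[of 0] b_one tail_sum_nonneg[of 1] 
      by (simp add: truncated_mass_eq_sum_tail)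
  next
    case (Suc k)
    then show ?thesis using Suc.IH tail_sum_nonneg[of n] by (simp add: truncated_mass_Suc)
  qed
qed simp

lemma moment_sum_mono: "m \<le> n \<Longrightarrow> moment_sum m \<le> moment_sum n"
  by (intro sum_mono2) (auto intro!: mult_nonneg_nonneg b_nonneg)

lemma moment_sum_ge_1: "n \<ge> 1 \<Longrightarrow> moment_sum n \<ge> 1"
  using moment_sum_mono[of 1 n] b_one by simp

lemma sum_mb_le: "(\<Sum>m=2..n. real m * b m) \<le> moment_sum n"
  by (intro sum_mono2) (auto intro!: mult_nonneg_nonneg b_nonneg)

lemma log_bound_nonneg:
  assumes B: "\<And>n. n \<ge> 1 \<Longrightarrow> moment_sum n \<le> B * real n / (ln (real (max n 3)))\<^sup>2"
  shows "B \<ge> 0"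
proof (rule ccontr)
  assume "\<not> B \<ge> 0"
  then have "B * real 1 / (ln (real (max 1 3)))\<^sup>2 \<le> 0" by (intro divide_nonpos_nonneg) auto
  with B[of 1] b_one show False by simp
qed

text \<open>
  Abel summation turns \<open>b m\<close> into differences of the moment sums divided by \<open>m\<close>, and what remains is a sum of terms
  \<open>O(1 / (m log\<^sup>2 m))\<close>.  These are dominated by the increments of \<open>- 1 / log (m + 2)\<close>, which makes the
  bound provable by induction; the shift by \<open>2\<close> keeps that function strictly monotone for small
  \<open>m\<close>, where \<open>log (max m 3)\<close> is constant.
\<close>
lemma partial_tail_sum_le:
  assumes B: "\<And>n. n \<ge> 1 \<Longrightarrow> moment_sum n \<le> B * real n / (ln (real (max n 3)))\<^sup>2" and n: "n \<ge> 1"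
  shows "(\<Sum>i<N. b (i + n + 1)) \<le> moment_sum (n + N) / real (n + N)
           + 16 * B * (1 / ln (real n + 2) - 1 / ln (real (n + N) + 2))"
proof (induction N)
  case 0
  have "moment_sum n \<ge> 0" using moment_sum_ge_1[OF n] by simp
  then show ?case by simp
next
  case (Suc N)
  define M where "M = n + N"
  define x where "x = real M"
  have M: "M \<ge> 1" and x: "x \<ge> 1" using n by (auto simp: M_def x_def)
  let ?l = "ln (real (max M 3))" and ?a = "ln (x + 2)" and ?c = "ln (x + 3)"
  have a: "?a > 0" and l: "?l > 0" using x by auto
  have ac: "?a \<le> ?c" using x by simp
  have "x + 3 \<le> (x + 2)\<^sup>2" using x by (simp add: power2_eq_square algebra_simps) 
  then have "?c \<le> ln ((x + 2)\<^sup>2)" using x by (intro ln_mono) auto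
  then have c2: "?c \<le> 2 * ?a" using x by (simp add: ln_realpow)
  have "x + 2 \<le> (real (max M 3))\<^sup>2"
  proof -
    have "x + 2 \<le> 3 * real (max M 3)" using x by (auto simp: x_def max_def)
    also have "\<dots> \<le> real (max M 3) * real (max M 3)" by (intro mult_right_mono) auto
    finally show ?thesis by (simp add: power2_eq_square)
  qed
  then have "?a \<le> ln ((real (max M 3))\<^sup>2)" using x by (intro ln_mono) auto
  then have a2: "?a \<le> 2 * ?l" by (simp add: ln_realpow)
  have B0: "B \<ge> 0" using B by (rule log_bound_nonneg)
  have "moment_sum M / (x * (x + 1)) \<le> B * x / ?l\<^sup>2 / (x * (x + 1))"
    using B[OF M] x by (intro divide_right_mono) (auto simp: x_def)
  also have "\<dots> = B / ((x + 1) * ?l\<^sup>2)" using x l by (simp add: divide_simps)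
  also have "\<dots> \<le> B / ((x + 1) * (?a / 2)\<^sup>2)"
    using a a2 x B0 l by (intro divide_left_mono mult_left_mono power_mono) auto
  also have "\<dots> = 4 * B / ((x + 1) * ?a\<^sup>2)" by (simp add: power2_eq_square field_simps)
  finally have 1: "moment_sum M / (x * (x + 1)) \<le> 4 * B / ((x + 1) * ?a\<^sup>2)" .
  have "ln ((x + 2) / (x + 3)) \<le> (x + 2) / (x + 3) - 1" using x by (intro ln_le_minus_one) auto
  also have "\<dots> = - (1 / (x + 3))" using x by (simp add: field_simps)
  finally have "1 / (x + 3) \<le> ?c - ?a" using x by (simp add: ln_div)
  then have "1 / (x + 3) / (?a * ?c) \<le> (?c - ?a) / (?a * ?c)"
    using a ac by (intro divide_right_mono) auto
  also have "\<dots> = 1 / ?a - 1 / ?c" using a ac by (simp add: field_simps)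
  finally have 2: "1 / (x + 3) / (?a * ?c) \<le> 1 / ?a - 1 / ?c" .
  have "1 / (4 * (x + 1) * ?a\<^sup>2) = 1 / ((2 * (x + 1)) * (?a * (2 * ?a)))"
    by (simp add: power2_eq_square)
  also have "\<dots> \<le> 1 / ((x + 3) * (?a * ?c))"
    using x a ac c2 by (intro divide_left_mono mult_mono mult_pos_pos) auto
  finally have 3: "1 / (4 * (x + 1) * ?a\<^sup>2) \<le> 1 / ?a - 1 / ?c" using 2 by simp
  have "4 * B / ((x + 1) * ?a\<^sup>2) = 16 * B * (1 / (4 * (x + 1) * ?a\<^sup>2))"
    using x a by (simp add: divide_simps)
  also have "\<dots> \<le> 16 * B * (1 / ?a - 1 / ?c)" using 3 B0 by (intro mult_left_mono) auto
  finally have 4: "moment_sum M / (x * (x + 1)) \<le> 16 * B * (1 / ?a - 1 / ?c)" using 1 by simp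
  have "moment_sum M / x + b (M + 1) = moment_sum M / (x * (x + 1)) + (moment_sum M + (x + 1) * b (M + 1)) / (x + 1)"
    using x by (simp add: divide_simps) (simp add: algebra_simps)
  also have "moment_sum M + (x + 1) * b (M + 1) = moment_sum (Suc M)" by (simp add: x_def algebra_simps)
  finally have 5: "moment_sum M / x + b (M + 1) = moment_sum M / (x * (x + 1)) + moment_sum (Suc M) / (x + 1)" .
  have 6: "(\<Sum>i<Suc N. b (i + n + 1)) \<le> moment_sum M / x + 16 * B * (1 / ln (real n + 2) - 1 / ?a) + b (M + 1)"
    using Suc.IH by (simp add: M_def x_def add_ac)
  have 7: "16 * B * (1 / ln (real n + 2) - 1 / ?a) + 16 * B * (1 / ?a - 1 / ?c)
      = 16 * B * (1 / ln (real n + 2) - 1 / ?c)"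
    by (simp add: algebra_simps)
  have "(\<Sum>i<Suc N. b (i + n + 1)) \<le> moment_sum (Suc M) / (x + 1) + 16 * B * (1 / ln (real n + 2) - 1 / ?c)"
    using 4 5 6 7 by linarith
  then show ?case by (simp add: M_def x_def add_ac)
qed

lemma tail_sum_le:
  assumes B: "\<And>n. n \<ge> 1 \<Longrightarrow> moment_sum n \<le> B * real n / (ln (real (max n 3)))\<^sup>2" and n: "n \<ge> 1"
  shows "tail_sum b n \<le> 17 * B / ln (real (max n 3))"
  unfolding tail_sum_def
proof (rule suminf_le_const[OF summable_tail])
  fix N
  let ?l = "ln (real (max n 3))" and ?m = "ln (real (max (n + N) 3))"
  have ln3: "1 \<le> ln (3::real)" using exp_le by (subst ln_ge_iff) auto
  then have l1: "?l \<ge> 1" by (rule order_trans) (intro ln_mono, auto)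
  have lm: "?l \<le> ?m" by (intro ln_mono) auto
  have B0: "B \<ge> 0" using B by (rule log_bound_nonneg)
  have "moment_sum (n + N) / real (n + N) \<le> B * real (n + N) / ?m\<^sup>2 / real (n + N)"
    using B[of "n + N"] n by (intro divide_right_mono) auto
  also have "\<dots> = B / ?m\<^sup>2" using n by simp
  also have "\<dots> \<le> B / ?l"
  proof (intro divide_left_mono B0)
    have "?l * 1 \<le> ?m * ?m" using l1 lm by (intro mult_mono) linarith+
    then show "?l \<le> ?m\<^sup>2" by (simp add: power2_eq_square)
    show "0 < ?m\<^sup>2 * ?l" using l1 lm by (intro mult_pos_pos zero_less_power) linarith+
  qed
  finally have 1: "moment_sum (n + N) / real (n + N) \<le> B / ?l" .
  have "?l \<le> ln (real n + 2)" using n by (intro ln_mono) auto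
  then have 2: "1 / ln (real n + 2) \<le> 1 / ?l" using l1 by (intro divide_left_mono) auto
  have "0 \<le> 1 / ln (real (n + N) + 2)" by simp
  then have "1 / ln (real n + 2) - 1 / ln (real (n + N) + 2) \<le> 1 / ?l"
    using 2 by linarith
  then have "16 * B * (1 / ln (real n + 2) - 1 / ln (real (n + N) + 2)) \<le> 16 * B * (1 / ?l)"
    using B0 by (intro mult_left_mono) auto
  then show "(\<Sum>i<N. b (i + n + 1)) \<le> 17 * B / ?l"
    using partial_tail_sum_le[OF B n, of N] 1 by (simp add: add_divide_distrib)
qed

end

section \<open>Deviation of a perturbed recursion from an exponential\<close>

lemma norm_iexp_minus_1_le: "cmod (exp (\<i> * of_real x) - 1) \<le> \<bar>x\<bar>"
  using iexp_approx1[of x 0] by simp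

lemma norm_iexp_minus_linear_le: "cmod (exp (\<i> * of_real x) - 1 - \<i> * of_real x) \<le> x\<^sup>2 / 2"
  using iexp_approx1[of x 1] by (simp add: algebra_simps power2_eq_square)

context bound_sequence begin

text \<open>
  The sequence \<open>u\<close> of the proof is \<open>\<phi>\<close> with the expected rotation removed.  As \<open>u\<close> is bounded by \<open>1\<close>,
  the recursion bounds its increments by \<open>2 \<Theta> r\<close>.  This crude bound is then fed back: replacing
  \<open>u (Suc k - m)\<close> by \<open>u k\<close> costs at most \<open>m\<close> increments against a coefficient \<open>O(r b m)\<close>, and what is
  left multiplies \<open>u k\<close> by a number whose first-order part cancels up to the tail of the series that
  defines \<open>s\<close>.
\<close>
lemma deviation_bound:
  fixes \<phi> :: "nat \<Rightarrow> complex" and q :: "nat \<Rightarrow> complex" and g :: "nat \<Rightarrow> real"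
  assumes E: "E \<ge> 0" and l: "l \<ge> 0" and r: "r \<ge> 0"
    and phi_0: "\<phi> 0 = 1" and phi_le: "\<And>n. cmod (\<phi> n) \<le> 1"
    and rec: "\<And>n. \<phi> (Suc n) = d * \<phi> n + (\<Sum>m=2..Suc n. q m * \<phi> (Suc n - m))"
    and d1: "cmod (d - 1) \<le> l * r" and d2: "cmod (d - 1 - \<i> * of_real a) \<le> (l * r)\<^sup>2 / 2"
    and a: "\<bar>a\<bar> \<le> l * r"
    and q1: "\<And>m. m \<ge> 2 \<Longrightarrow> cmod (q m) \<le> E * r * b m"
    and q2: "\<And>m. m \<ge> 2 \<Longrightarrow> cmod (q m - \<i> * of_real (g m)) \<le> E * r\<^sup>2 * real m * b m"
    and g: "\<And>m. m \<ge> 2 \<Longrightarrow> \<bar>g m\<bar> \<le> E * r * b m"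
    and s: "s = a + (\<Sum>i. g (i + 2))"
    and Theta: "\<Theta> = l + E * tail_sum b 0"
    and n: "n \<ge> 1"
  shows "cmod (\<phi> n * exp (- \<i> * of_real s) ^ n - 1) \<le>
    (E + 2 * \<Theta>\<^sup>2 + E * (1 + 3 * \<Theta>)) * (r * truncated_mass b n + real n * r\<^sup>2 * moment_sum n)"
proof -
  \<comment> \<open>One step of the expected rotation.\<close>
  define w where "w = exp (- \<i> * of_real s)"
  define u where "u n = \<phi> n * w ^ n" for n
  have Theta_nonneg: "\<Theta> \<ge> 0" using E l tail_sum_nonneg[of 0] by (simp add: Theta)
  have sg: "summable (\<lambda>i. g (i + k + 2))" for k
  proof (rule summable_comparison_test[OF _ summable_mult[OF summable_tail[of "k + 1"], of "E * r"]])
    show "\<exists>N. \<forall>i\<ge>N. norm (g (i + k + 2)) \<le> E * r * b (i + (k + 1) + 1)"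
      using g[of "_ + k + 2"] by (auto simp: add_ac)
  qed
  have tail_g: "\<bar>\<Sum>i. g (i + k + 2)\<bar> \<le> E * r * tail_sum b (k + 1)" for k
  proof -
    have "norm (\<Sum>i. g (i + k + 2)) \<le> (\<Sum>i. E * r * b (i + (k + 1) + 1))"
      by (rule norm_suminf_le[OF _ summable_mult[OF summable_tail]])
         (use g[of "_ + k + 2"] in \<open>auto simp: add_ac\<close>)
    also have "\<dots> = E * r * tail_sum b (k + 1)"
      unfolding tail_sum_def by (rule suminf_mult[OF summable_tail])
    finally show ?thesis by simp
  qed
  have sr: "\<bar>s\<bar> \<le> \<Theta> * r"
  proof -
    have "E * r * tail_sum b 1 \<le> E * r * tail_sum b 0"
      using E r tail_sum_le_0[of 1] by (intro mult_left_mono) auto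
    with tail_g[of 0] a have "\<bar>s\<bar> \<le> l * r + E * r * tail_sum b 0" by (simp add: s)
    then show ?thesis by (simp add: Theta algebra_simps)
  qed
  have w: "w = exp (\<i> * of_real (- s))" by (simp add: w_def)
  have nw: "cmod w = 1" unfolding w by (rule norm_exp_i_times)
  have w1: "cmod (w - 1) \<le> \<bar>s\<bar>" using norm_iexp_minus_1_le[of "- s"] by (simp add: w)
  have w2: "cmod (w - 1 + \<i> * of_real s) \<le> s\<^sup>2 / 2"
    using norm_iexp_minus_linear_le[of "- s"] by (simp add: w)
  have wm: "cmod (w ^ m - 1) \<le> real m * (\<Theta> * r)" for m
  proof -
    have "cmod (w ^ m - 1 ^ m) \<le> real m * cmod (w - 1)"
      by (rule norm_power_diff) (auto simp: nw)
    also have "\<dots> \<le> real m * (\<Theta> * r)" using w1 sr by (intro mult_left_mono) auto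
    finally show ?thesis by simp
  qed
  have u_le: "cmod (u n) \<le> 1" for n
    using phi_le[of n] by (simp add: u_def norm_mult norm_power nw)
  have u_rec: "u (Suc n) = d * w * u n + (\<Sum>m=2..Suc n. q m * w ^ m * u (Suc n - m))" for n
  proof -
    have "u (Suc n) = d * w * u n + (\<Sum>m=2..Suc n. q m * \<phi> (Suc n - m)) * w ^ Suc n"
      unfolding u_def rec by (simp add: distrib_right distrib_left mult_ac del: sum.cl_ivl_Suc)
    also have "(\<Sum>m=2..Suc n. q m * \<phi> (Suc n - m)) * w ^ Suc n =
        (\<Sum>m=2..Suc n. q m * w ^ m * u (Suc n - m))"
      unfolding sum_distrib_right
    proof (intro sum.cong refl)
      fix m assume "m \<in> {2..Suc n}"
      then have "w ^ Suc n = w ^ m * w ^ (Suc n - m)" by (simp flip: power_add)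
      then show "q m * \<phi> (Suc n - m) * w ^ Suc n = q m * w ^ m * u (Suc n - m)"
        by (simp only: u_def mult_ac)
    qed
    finally show ?thesis .
  qed
  have Er_b: "E * r * b m \<ge> 0" if "m \<ge> 1" for m using E r b_nonneg[OF that] by simp
  have sum_Erb: "(\<Sum>m=2..k. E * r * b m) \<le> E * r * tail_sum b 0" for k
    unfolding sum_distrib_left[symmetric] using E r sum_b_le[of k] by (intro mult_left_mono) auto
  have dw1: "cmod (d * w - 1) \<le> l * r + \<Theta> * r"
  proof -
    have "d * w - 1 = (d - 1) * w + (w - 1)" by (simp add: algebra_simps)
    then have "cmod (d * w - 1) \<le> cmod (d - 1) * cmod w + cmod (w - 1)"
      by (metis norm_mult norm_triangle_ineq)
    then show ?thesis using d1 w1 sr nw by simp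
  qed
  have incr: "cmod (u (Suc k) - u k) \<le> 2 * \<Theta> * r" for k
  proof -
    have "u (Suc k) - u k = (d * w - 1) * u k + (\<Sum>m=2..Suc k. q m * w ^ m * u (Suc k - m))"
      unfolding u_rec by (simp add: algebra_simps)
    also have "cmod \<dots> \<le> (l * r + \<Theta> * r) + E * r * tail_sum b 0"
    proof (rule norm_triangle_le, rule add_mono)
      show "cmod ((d * w - 1) * u k) \<le> l * r + \<Theta> * r"
        using mult_mono[OF dw1 u_le[of k]] dw1 norm_ge_zero[of "d * w - 1"]
        by (simp add: norm_mult) 
      have "cmod (\<Sum>m=2..Suc k. q m * w ^ m * u (Suc k - m)) \<le> (\<Sum>m=2..Suc k. E * r * b m)"
      proof (rule sum_norm_le)
        fix m assume "m \<in> {2..Suc k}"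
        then have m: "m \<ge> 2" by simp
        have "cmod (q m * w ^ m * u (Suc k - m)) \<le> cmod (q m) * 1"
          unfolding norm_mult norm_power nw using u_le by (simp add: mult_left_le)
        then show "cmod (q m * w ^ m * u (Suc k - m)) \<le> E * r * b m" using q1[OF m] by simp
      qed
      from this sum_Erb show "cmod (\<Sum>m=2..Suc k. q m * w ^ m * u (Suc k - m)) \<le> E * r * tail_sum b 0"
        by (rule order_trans)
    qed
    finally show ?thesis by (simp add: Theta algebra_simps)
  qed
  have incrs: "cmod (u (k + m) - u k) \<le> real m * (2 * \<Theta> * r)" for k m
  proof (induction m)
    case (Suc m)
    have "cmod (u (k + Suc m) - u k) \<le> cmod (u (Suc (k + m)) - u (k + m)) + cmod (u (k + m) - u k)"
      using norm_triangle_ineq[of "u (Suc (k + m)) - u (k + m)" "u (k + m) - u k"] by simp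
    with Suc.IH incr[of "k + m"] show ?case by (simp add: algebra_simps)
  qed simp
  have dw2: "cmod (d * w - 1 - \<i> * of_real (a - s)) \<le> 2 * \<Theta>\<^sup>2 * r\<^sup>2"
  proof -
    have l_le: "l * r \<le> \<Theta> * r"
      using E tail_sum_nonneg[of 0] r by (intro mult_right_mono) (auto simp: Theta)
    have "d * w - 1 - \<i> * of_real (a - s) =
        (d - 1 - \<i> * of_real a) * w + (w - 1 + \<i> * of_real s) + \<i> * of_real a * (w - 1)"
      by (simp add: algebra_simps)
    also have "cmod \<dots> \<le> cmod (d - 1 - \<i> * of_real a) + cmod (w - 1 + \<i> * of_real s) + \<bar>a\<bar> * cmod (w - 1)"
      by (rule norm_triangle_le, rule add_mono, rule norm_triangle_le) (auto simp: norm_mult nw)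
    also have "\<dots> \<le> (\<Theta> * r)\<^sup>2 / 2 + (\<Theta> * r)\<^sup>2 / 2 + (\<Theta> * r) * (\<Theta> * r)"
    proof (intro add_mono mult_mono)
      show "cmod (d - 1 - \<i> * of_real a) \<le> (\<Theta> * r)\<^sup>2 / 2"
        using d2 l_le l r by (elim order_trans) (intro divide_right_mono power_mono, auto)
      have "s\<^sup>2 \<le> (\<Theta> * r)\<^sup>2" using sr by (intro abs_le_square_iff[THEN iffD1]) simp
      then show "cmod (w - 1 + \<i> * of_real s) \<le> (\<Theta> * r)\<^sup>2 / 2" using w2 by simp
    qed (use a l_le w1 sr Theta_nonneg r in auto)
    finally show ?thesis by (simp add: power2_eq_square mult_ac)
  qed
  have qw2: "cmod (q m * w ^ m - \<i> * of_real (g m)) \<le> E * (1 + \<Theta>) * r\<^sup>2 * (real m * b m)" if m: "m \<ge> 2" for m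
  proof -
    have "q m * w ^ m - \<i> * of_real (g m) = (q m - \<i> * of_real (g m)) * w ^ m + \<i> * of_real (g m) * (w ^ m - 1)"
      by (simp add: algebra_simps)
    also have "cmod \<dots> \<le> cmod (q m - \<i> * of_real (g m)) + \<bar>g m\<bar> * cmod (w ^ m - 1)"
      by (rule norm_triangle_le) (auto simp: norm_mult norm_power nw)
    also have "\<dots> \<le> E * r\<^sup>2 * real m * b m + (E * r * b m) * (real m * (\<Theta> * r))"
      using q2[OF m] g[OF m] wm[of m] m Er_b[of m] by (intro add_mono mult_mono) auto
    finally show ?thesis by (simp add: algebra_simps power2_eq_square)
  qed
  have fine: "cmod (u (Suc k) - u k) \<le> E * r * tail_sum b k + (2 * \<Theta>\<^sup>2 + E * (1 + 3 * \<Theta>)) * r\<^sup>2 * moment_sum n"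
    if k: "k < n" for k
  proof -
    \<comment> \<open>\<open>A\<close> is the coefficient of \<open>u k\<close> after all delayed values of \<open>u\<close> have been replaced by \<open>u k\<close>.\<close>
    define A where "A = d * w - 1 + (\<Sum>m=2..Suc k. q m * w ^ m)"
    have "s = a + ((\<Sum>i<k. g (i + 2)) + (\<Sum>i. g (i + k + 2)))"
      using suminf_split_initial_segment[OF sg[of 0], of k] by (simp add: s)
    also have "(\<Sum>i<k. g (i + 2)) = (\<Sum>m=2..Suc k. g m)"
      by (rule sum.reindex_bij_witness[of _ "\<lambda>m. m - 2" "\<lambda>i. i + 2"]) auto
    finally have s_eq: "s = a + (\<Sum>m=2..Suc k. g m) + (\<Sum>i. g (i + k + 2))" by simp
    have "A = (d * w - 1 - \<i> * of_real (a - s)) + (\<Sum>m=2..Suc k. q m * w ^ m - \<i> * of_real (g m))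
         + \<i> * of_real (a - s + (\<Sum>m=2..Suc k. g m))"
      by (simp add: A_def sum_subtractf sum_distrib_left algebra_simps del: sum.cl_ivl_Suc)
    also have "a - s + (\<Sum>m=2..Suc k. g m) = - (\<Sum>i. g (i + k + 2))" using s_eq by simp
    also have "cmod (d * w - 1 - \<i> * of_real (a - s) + (\<Sum>m=2..Suc k. q m * w ^ m - \<i> * of_real (g m))
         + \<i> * of_real (- (\<Sum>i. g (i + k + 2)))) \<le>
         2 * \<Theta>\<^sup>2 * r\<^sup>2 + E * (1 + \<Theta>) * r\<^sup>2 * moment_sum n + E * r * tail_sum b k"
    proof (rule norm_triangle_le, rule add_mono, rule norm_triangle_le, rule add_mono)
      have "cmod (\<Sum>m=2..Suc k. q m * w ^ m - \<i> * of_real (g m)) \<le>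
          (\<Sum>m=2..Suc k. E * (1 + \<Theta>) * r\<^sup>2 * (real m * b m))"
        by (rule sum_norm_le) (use qw2 in auto)
      also have "\<dots> \<le> E * (1 + \<Theta>) * r\<^sup>2 * moment_sum n"
        unfolding sum_distrib_left[symmetric] using k E Theta_nonneg
        by (intro mult_left_mono order_trans[OF sum_mb_le moment_sum_mono]) auto
      finally show "cmod (\<Sum>m=2..Suc k. q m * w ^ m - \<i> * of_real (g m)) \<le> E * (1 + \<Theta>) * r\<^sup>2 * moment_sum n" .
      have "E * r * tail_sum b (k + 1) \<le> E * r * tail_sum b k"
        using E r tail_sum_Suc_le[of k] by (intro mult_left_mono) auto
      with tail_g[of k] show "cmod (\<i> * of_real (- (\<Sum>i. g (i + k + 2)))) \<le> E * r * tail_sum b k"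
        by (simp add: norm_mult)
    qed (rule dw2)
    finally have A: "cmod A \<le> 2 * \<Theta>\<^sup>2 * r\<^sup>2 + E * (1 + \<Theta>) * r\<^sup>2 * moment_sum n + E * r * tail_sum b k" .
    have "u (Suc k) - u k = A * u k + (\<Sum>m=2..Suc k. q m * w ^ m * (u (Suc k - m) - u k))"
      unfolding u_rec A_def
      by (simp add: algebra_simps sum_subtractf sum_distrib_left del: sum.cl_ivl_Suc)
    also have "cmod \<dots> \<le> (2 * \<Theta>\<^sup>2 * r\<^sup>2 + E * (1 + \<Theta>) * r\<^sup>2 * moment_sum n + E * r * tail_sum b k)
        + 2 * E * \<Theta> * r\<^sup>2 * moment_sum n"
    proof (rule norm_triangle_le, rule add_mono)
      show "cmod (A * u k) \<le> 2 * \<Theta>\<^sup>2 * r\<^sup>2 + E * (1 + \<Theta>) * r\<^sup>2 * moment_sum n + E * r * tail_sum b k"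
        using mult_left_le[OF u_le[of k] norm_ge_zero[of A]] A by (simp add: norm_mult)
      have "cmod (\<Sum>m=2..Suc k. q m * w ^ m * (u (Suc k - m) - u k)) \<le>
          (\<Sum>m=2..Suc k. 2 * E * \<Theta> * r\<^sup>2 * (real m * b m))"
      proof (rule sum_norm_le)
        fix m assume m: "m \<in> {2..Suc k}"
        have "cmod (u (Suc k - m) - u k) \<le> real (m - 1) * (2 * \<Theta> * r)"
          using incrs[of "Suc k - m" "m - 1"] m by (simp add: norm_minus_commute)
        also have "\<dots> \<le> real m * (2 * \<Theta> * r)" using Theta_nonneg r by (intro mult_right_mono) auto
        finally have "cmod (q m) * cmod (u (Suc k - m) - u k) \<le> (E * r * b m) * (real m * (2 * \<Theta> * r))"
          using q1[of m] m Er_b[of m] by (intro mult_mono) auto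
        then show "cmod (q m * w ^ m * (u (Suc k - m) - u k)) \<le> 2 * E * \<Theta> * r\<^sup>2 * (real m * b m)"
          by (simp add: norm_mult norm_power nw power2_eq_square mult_ac)
      qed
      also have "\<dots> \<le> 2 * E * \<Theta> * r\<^sup>2 * moment_sum n"
        unfolding sum_distrib_left[symmetric] using k E Theta_nonneg
        by (intro mult_left_mono order_trans[OF sum_mb_le moment_sum_mono]) auto
      finally show "cmod (\<Sum>m=2..Suc k. q m * w ^ m * (u (Suc k - m) - u k)) \<le> 2 * E * \<Theta> * r\<^sup>2 * moment_sum n" .
    qed
    also have "2 * \<Theta>\<^sup>2 * r\<^sup>2 \<le> 2 * \<Theta>\<^sup>2 * r\<^sup>2 * moment_sum n"
      using moment_sum_ge_1[OF n] mult_left_mono[of 1 "moment_sum n" "2 * \<Theta>\<^sup>2 * r\<^sup>2"] by simp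
    finally show ?thesis by (simp add: algebra_simps)
  qed
  let ?C = "2 * \<Theta>\<^sup>2 + E * (1 + 3 * \<Theta>)"
  have "cmod (u n - u 0) = cmod (\<Sum>k<n. u (Suc k) - u k)"
    by (simp add: sum_lessThan_telescope)
  also have "\<dots> \<le> (\<Sum>k<n. E * r * tail_sum b k + ?C * r\<^sup>2 * moment_sum n)"
    by (rule sum_norm_le) (use fine in auto)
  also have "\<dots> = E * (r * truncated_mass b n) + ?C * (real n * r\<^sup>2 * moment_sum n)"
    unfolding sum.distrib truncated_mass_eq_sum_tail sum_distrib_left[symmetric] sum_constant
    by (simp add: mult_ac)
  also have "\<dots> \<le> (E + ?C) * (r * truncated_mass b n) + (E + ?C) * (real n * r\<^sup>2 * moment_sum n)"
  proof (rule add_mono; rule mult_right_mono)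
    have "?C \<ge> 0" using E Theta_nonneg by simp
    then show "E \<le> E + ?C" by linarith
    show "?C \<le> E + ?C" using E by linarith
    show "0 \<le> r * truncated_mass b n" using r truncated_mass_ge_1[OF n] by simp
    show "0 \<le> real n * r\<^sup>2 * moment_sum n" using moment_sum_ge_1[OF n] by simp
  qed
  finally show ?thesis
    unfolding u_def w_def by (simp add: phi_0 algebra_simps)
qed

end

context finite_range_law begin

section \<open>First moments\<close>

lemma range_nonneg: "L \<ge> 0"
proof -
  have "steps L \<noteq> ({} :: (int ^ 'd) set)"
    using sum_pmf_steps[of "[0]"] by auto
  then obtain v :: "int ^ 'd" where "norm (rvec v) \<le> L" by (auto simp: steps_def)
  then show ?thesis using norm_ge_zero[of "rvec v"] by linarith
qed

lemma sum_first_step: "(\<Sum>v\<in>steps L. first_step p v) = 1"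
  using sum_pmf_steps[of "[0]"] by (simp add: first_step_def)

lemma first_step_nonneg: "first_step p v \<ge> 0"
  by (simp add: first_step_def)

lemma sum_first_step_le:
  assumes "\<And>v. v \<in> steps L \<Longrightarrow> norm (f v) \<le> c"
  shows "norm (\<Sum>v\<in>steps L. first_step p v *\<^sub>R f v) \<le> c"
proof -
  have "norm (\<Sum>v\<in>steps L. first_step p v *\<^sub>R f v) \<le> (\<Sum>v\<in>steps L. first_step p v * c)"
    by (rule sum_norm_le) (auto intro!: mult_left_mono assms simp: first_step_nonneg)
  then show ?thesis by (simp add: sum_first_step flip: sum_distrib_right)
qed

definition mean_step :: "real ^ 'd" where
  "mean_step = (\<Sum>v\<in>steps L. first_step p v *\<^sub>R rvec v)"

lemma infsum_first_step: "(\<Sum>\<^sub>\<infinity>x. first_step p x *\<^sub>R rvec x) = mean_step"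
proof -
  have "(\<Sum>\<^sub>\<infinity>x. first_step p x *\<^sub>R rvec x) = (\<Sum>\<^sub>\<infinity>x\<in>steps L. first_step p x *\<^sub>R rvec x)"
    by (rule infsum_cong_neutral) (auto simp: first_step_eq_0)
  then show ?thesis by (simp add: mean_step_def)
qed

lemma norm_mean_step: "norm mean_step \<le> L"
  unfolding mean_step_def by (rule sum_first_step_le) (simp add: steps_def)

lemma abs_inner_step: "v \<in> steps L \<Longrightarrow> \<bar>k \<bullet> rvec v\<bar> \<le> L * norm k"
  using Cauchy_Schwarz_ineq2[of k "rvec v"] mult_left_mono[of "norm (rvec v)" L "norm k"]
  by (simp add: steps_def mult.commute)

lemma norm_step_hat_minus_1: "cmod (step_hat k - 1) \<le> L * norm k"
proof -
  have "step_hat k - 1 = step_hat k - of_real (\<Sum>v\<in>steps L. first_step p v)"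
    by (simp add: sum_first_step)
  also have "\<dots> = (\<Sum>v\<in>steps L. first_step p v *\<^sub>R (wave k v - 1))"
    by (simp add: step_hat_def sum_subtractf algebra_simps scaleR_conv_of_real)
  also have "cmod \<dots> \<le> L * norm k"
  proof (rule sum_first_step_le)
    fix v :: "int ^ 'd" assume "v \<in> steps L"
    then show "cmod (wave k v - 1) \<le> L * norm k"
      using norm_iexp_minus_1_le[of "k \<bullet> rvec v"] abs_inner_step[of v k] by (simp add: wave_def)
  qed
  finally show ?thesis .
qed

lemma norm_step_hat_minus_linear:
  "cmod (step_hat k - 1 - \<i> * of_real (k \<bullet> mean_step)) \<le> (L * norm k)\<^sup>2 / 2"
proof -
  have inner: "complex_of_real (k \<bullet> mean_step) =
      (\<Sum>v\<in>steps L. of_real (first_step p v) * of_real (k \<bullet> rvec v))"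
    by (simp add: mean_step_def inner_sum_right)
  have "step_hat k - 1 - \<i> * of_real (k \<bullet> mean_step) =
      step_hat k - of_real (\<Sum>v\<in>steps L. first_step p v) - \<i> * of_real (k \<bullet> mean_step)"
    by (simp add: sum_first_step)
  also have "\<dots> = (\<Sum>v\<in>steps L. first_step p v *\<^sub>R (wave k v - 1 - \<i> * of_real (k \<bullet> rvec v)))"
    unfolding inner
    by (simp add: step_hat_def sum_distrib_left sum_subtractf sum.distrib algebra_simps scaleR_conv_of_real)
  also have "cmod \<dots> \<le> (L * norm k)\<^sup>2 / 2"
  proof (rule sum_first_step_le)
    fix v :: "int ^ 'd" assume "v \<in> steps L"
    then have "(k \<bullet> rvec v)\<^sup>2 \<le> (L * norm k)\<^sup>2"
      using abs_inner_step[of v k] by (intro abs_le_square_iff[THEN iffD1]) simp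
    then show "cmod (wave k v - 1 - \<i> * of_real (k \<bullet> rvec v)) \<le> (L * norm k)\<^sup>2 / 2"
      using norm_iexp_minus_linear_le[of "k \<bullet> rvec v"] by (simp add: wave_def)
  qed
  finally show ?thesis .
qed

definition expected_vertex :: "nat \<Rightarrow> real ^ 'd" where
  "expected_vertex n = (\<Sum>V\<in>paths L n 0. path_prob [0] V *\<^sub>R rvec (last (0 # V)))"

lemma char_from_eq_sum_paths_0:
  "char_from k n [0] = (\<Sum>V\<in>paths L n 0. of_real (path_prob [0] V) * wave k (last (0 # V)))"
  by (simp add: char_from_eq_sum_paths[of k n "[0]"] del: last.simps) simp

lemma char_from_has_vector_derivative:
  "((\<lambda>t. char_from (t *\<^sub>R h) n [0]) has_vector_derivative
     (\<Sum>V\<in>paths L n 0. of_real (path_prob [0] V) *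
        (\<i> * of_real (h \<bullet> rvec (last (0 # V))) * wave (t *\<^sub>R h) (last (0 # V))))) (at t within T)"
  using wave_sum_has_vector_derivative[where A = "paths L n 0" and c = "path_prob [0]" and k = 0
    and h = h and x = "\<lambda>V. last (0 # V)" and t = t and S = T]
  by (simp add: char_from_eq_sum_paths_0 del: last.simps)

lemma char_from_has_vector_derivative_0:
  "((\<lambda>t. char_from (t *\<^sub>R h) n [0]) has_vector_derivative \<i> * of_real (h \<bullet> expected_vertex n)) (at 0)"
  using char_from_has_vector_derivative[of h n 0 UNIV]
  by (simp add: expected_vertex_def inner_sum_right sum_distrib_left mult_ac del: last.simps)

lemma step_hat_has_vector_derivative:
  "((\<lambda>t. step_hat (t *\<^sub>R h)) has_vector_derivative \<i> * of_real (h \<bullet> mean_step)) (at 0)"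
  using wave_sum_has_vector_derivative[where A = "steps L" and c = "first_step p" and k = 0
    and h = h and x = "\<lambda>v. v" and t = 0 and S = UNIV]
  by (simp add: step_hat_def mean_step_def inner_sum_right sum_distrib_left mult_ac)

text \<open>
  The derivatives at \<open>0\<close> of the two sides of \<open>char_recursion\<close> in every direction \<open>h\<close>.  As \<open>pi_hat\<close>
  vanishes at \<open>0\<close> and all characteristic functions are \<open>1\<close> there, neither the delayed means nor any
  products survive.
\<close>
lemma expected_vertex_Suc:
  assumes "\<And>m. m \<ge> 2 \<Longrightarrow> pi_hat p m 0 = 0"
  shows "expected_vertex (Suc n) = expected_vertex n + mean_step + (\<Sum>m=2..Suc n. drift m)"
proof -
  have "h \<bullet> expected_vertex (Suc n) = h \<bullet> (expected_vertex n + mean_step + (\<Sum>m=2..Suc n. drift m))" for h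
  proof -
    have "((\<lambda>t. step_hat (t *\<^sub>R h) * char_from (t *\<^sub>R h) n [0] +
          (\<Sum>m=2..Suc n. pi_hat p m (t *\<^sub>R h) * char_from (t *\<^sub>R h) (Suc n - m) [0])) has_vector_derivative
       (step_hat (0 *\<^sub>R h) * (\<i> * of_real (h \<bullet> expected_vertex n)) + \<i> * of_real (h \<bullet> mean_step) * char_from (0 *\<^sub>R h) n [0]) +
       (\<Sum>m=2..Suc n. pi_hat p m (0 *\<^sub>R h) * (\<i> * of_real (h \<bullet> expected_vertex (Suc n - m))) +
           \<i> * of_real (h \<bullet> drift m) * char_from (0 *\<^sub>R h) (Suc n - m) [0])) (at 0)"
      by (intro has_vector_derivative_add has_vector_derivative_sum has_vector_derivative_mult
          char_from_has_vector_derivative_0 step_hat_has_vector_derivative pi_hat_has_vector_derivative)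
    then have 1: "((\<lambda>t. char_from (t *\<^sub>R h) (Suc n) [0]) has_vector_derivative
       (step_hat (0 *\<^sub>R h) * (\<i> * of_real (h \<bullet> expected_vertex n)) + \<i> * of_real (h \<bullet> mean_step) * char_from (0 *\<^sub>R h) n [0]) +
       (\<Sum>m=2..Suc n. pi_hat p m (0 *\<^sub>R h) * (\<i> * of_real (h \<bullet> expected_vertex (Suc n - m))) +
           \<i> * of_real (h \<bullet> drift m) * char_from (0 *\<^sub>R h) (Suc n - m) [0])) (at 0)"
      unfolding char_recursion .
    have s0: "step_hat 0 = 1" using sum_first_step by (simp add: step_hat_def flip: of_real_sum)
    have "(\<Sum>m=2..Suc n. pi_hat p m (0 *\<^sub>R h) * (\<i> * of_real (h \<bullet> expected_vertex (Suc n - m))) +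
           \<i> * of_real (h \<bullet> drift m) * char_from (0 *\<^sub>R h) (Suc n - m) [0]) = (\<Sum>m=2..Suc n. \<i> * of_real (h \<bullet> drift m))"
      by (intro sum.cong refl) (simp add: assms char_from_0)
    with 1 have "((\<lambda>t. char_from (t *\<^sub>R h) (Suc n) [0]) has_vector_derivative
        \<i> * of_real (h \<bullet> (expected_vertex n + mean_step + (\<Sum>m=2..Suc n. drift m)))) (at 0)"
      by (simp add: s0 char_from_0 inner_add_right inner_sum_right sum_distrib_left algebra_simps del: char_from.simps sum.cl_ivl_Suc)
    from vector_derivative_unique_at[OF this char_from_has_vector_derivative_0[of h "Suc n"]]
    have "complex_of_real (h \<bullet> (expected_vertex n + mean_step + (\<Sum>m=2..Suc n. drift m))) = of_real (h \<bullet> expected_vertex (Suc n))"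
      by (simp only: mult_cancel_left complex_i_not_zero simp_thms)
    then show ?thesis by (simp only: of_real_eq_iff)
  qed
  then show ?thesis by (metis vector_eq_ldot)
qed

lemma mean_position_eq:
  assumes "is_walk_law p Q" shows "mean_position Q n = expected_vertex n"
  unfolding mean_position_def expected_vertex_def by (rule integral_position[OF assms])

lemma scaled_char_eq:
  assumes "is_walk_law p Q" shows "scaled_char Q n k = char_from ((1 / real n) *\<^sub>R k) n [0]"
proof -
  have "scaled_char Q n k = (\<integral>\<omega>. wave ((1 / real n) *\<^sub>R k) (\<omega> n) \<partial>Q)"
    by (simp add: scaled_char_def wave_def)
  then show ?thesis
    by (simp add: integral_position[OF assms] char_from_eq_sum_paths_0 scaleR_conv_of_real del: last.simps)
qed

lemma norm_last_paths: "V \<in> paths L n z \<Longrightarrow> norm (rvec (last (z # V) - z)) \<le> L * real n"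
proof (induction n arbitrary: z V)
  case (Suc n)
  then obtain v U where V: "V = (z + v) # U" "v \<in> steps L" "U \<in> paths L n (z + v)" by auto
  have "rvec (last (z # V) - z) = rvec (last ((z + v) # U) - (z + v)) + rvec v"
    by (simp add: V(1) flip: rvec_add)
  also have "norm \<dots> \<le> L * real n + L"
    using Suc.IH[OF V(3)] V(2) by (intro norm_triangle_le add_mono) (auto simp: steps_def)
  finally show ?case by (simp add: algebra_simps)
qed simp

end

section \<open>The distinguished logarithm\<close>

text \<open>
  Uniqueness of continuous logarithms: the difference of two of them takes values in the discrete
  set \<open>2 \<pi> \<i> \<int>\<close>, hence is constant on the interval.
\<close>
lemma distinguished_log_eqI:
  assumes cont: "continuous_on {0..1} g" and g0: "g 0 = 0"
    and exp_g: "\<And>t. t \<in> {0..1} \<Longrightarrow> exp (g t) = f (t *\<^sub>R k)"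
  shows "distinguished_log f k = g 1"
  unfolding distinguished_log_def
proof (rule the_equality)
  show "\<exists>h. continuous_on {0..1} h \<and> h 0 = 0 \<and> h 1 = g 1 \<and> (\<forall>t\<in>{0..1}. exp (h t) = f (t *\<^sub>R k))"
    using assms by blast
next
  fix w assume "\<exists>h. continuous_on {0..1} h \<and> h 0 = 0 \<and> h 1 = w \<and> (\<forall>t\<in>{0..1}. exp (h t) = f (t *\<^sub>R k))"
  then obtain h where h: "continuous_on {0..1} h" "h 0 = 0" "h 1 = w"
    "\<And>t. t \<in> {0..1} \<Longrightarrow> exp (h t) = f (t *\<^sub>R k)" by blast
  define j where "j t = h t - g t" for t :: real
  have j_int: "\<exists>n::int. j t = of_int (2 * n) * of_real pi * \<i>" if "t \<in> {0..1}" for t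
  proof -
    have "exp (h t) = exp (g t)" using h(4) exp_g that by simp
    then obtain n :: int where "h t = g t + of_int (2 * n) * of_real pi * \<i>"
      unfolding exp_eq by auto
    then show ?thesis by (auto simp: j_def)
  qed
  have "j constant_on {0..1}"
  proof (rule continuous_discrete_range_constant)
    show "continuous_on {0..1} j" unfolding j_def by (intro continuous_intros h cont)
    fix x :: real assume x: "x \<in> {0..1}"
    show "\<exists>e>0. \<forall>y. y \<in> {0..1} \<and> j y \<noteq> j x \<longrightarrow> e \<le> norm (j y - j x)"
    proof (intro exI[of _ "2 * pi"] conjI allI impI)
      fix y assume y: "y \<in> {0..1} \<and> j y \<noteq> j x"
      from j_int[OF x] obtain a :: int where a: "j x = of_int (2 * a) * of_real pi * \<i>" by auto
      from y j_int[of y] obtain c :: int where c: "j y = of_int (2 * c) * of_real pi * \<i>" by auto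
      have "a \<noteq> c" using y a c by auto
      then have "1 \<le> \<bar>real_of_int (c - a)\<bar>" by linarith
      moreover have "j y - j x = of_real (2 * pi * real_of_int (c - a)) * \<i>"
        by (simp add: a c algebra_simps)
      then have "norm (j y - j x) = 2 * pi * \<bar>real_of_int (c - a)\<bar>"
        by (simp only: norm_mult norm_of_real norm_ii abs_mult) simp
      ultimately show "2 * pi \<le> norm (j y - j x)"
        using mult_left_mono[of 1 "\<bar>real_of_int (c - a)\<bar>" "2 * pi"] by simp
    qed simp
  qed simp
  then have "j 1 = j 0" by (auto simp: constant_on_def)
  then show "w = g 1" using h g0 by (simp add: j_def)
qed

text \<open>
  Where the function is bounded away from \<open>0\<close>, its logarithm is the integral of the logarithmic
  derivative.
\<close>
lemma norm_distinguished_log_le: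
  assumes deriv: "\<And>t. t \<in> {0..1} \<Longrightarrow> ((\<lambda>t. f (t *\<^sub>R k)) has_vector_derivative F' t) (at t within {0..1})"
    and cont: "continuous_on {0..1} F'" and f0: "f 0 = 1"
    and lower: "\<And>t. t \<in> {0..1} \<Longrightarrow> cmod (f (t *\<^sub>R k)) \<ge> \<eta>" and eta: "\<eta> > 0"
    and upper: "\<And>t. t \<in> {0..1} \<Longrightarrow> cmod (F' t) \<le> M"
  shows "cmod (distinguished_log f k) \<le> M / \<eta>"
proof -
  define F where "F t = f (t *\<^sub>R k)" for t :: real
  have nz: "F t \<noteq> 0" if "t \<in> {0..1}" for t
    using lower[OF that] eta by (auto simp: F_def)
  have dF: "(F has_vector_derivative F' t) (at t within {0..1})" if "t \<in> {0..1}" for t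
    using deriv[OF that] by (simp add: F_def[abs_def])
  have contF: "continuous_on {0..1} F"
    using dF by (meson continuous_on_eq_continuous_within has_vector_derivative_continuous)
  define g where "g t = integral {0..t} (\<lambda>s. F' s / F s)" for t
  have cont_q: "continuous_on {0..1} (\<lambda>s. F' s / F s)"
    by (intro continuous_intros cont contF) (use nz in auto)
  have dg: "(g has_vector_derivative F' t / F t) (at t within {0..1})" if "t \<in> {0..1}" for t
    unfolding g_def by (rule integral_has_vector_derivative[OF cont_q that])
  have g0: "g 0 = 0" by (simp add: g_def)
  have "((\<lambda>t. F t * exp (- g t)) has_vector_derivative 0) (at t within {0..1})" if t: "t \<in> {0..1}" for t
  proof -
    have "((\<lambda>t. - g t) has_vector_derivative - (F' t / F t)) (at t within {0..1})"
      using dg[OF t] by (rule has_vector_derivative_minus)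
    then have "(exp \<circ> (\<lambda>t. - g t) has_vector_derivative - (F' t / F t) * exp (- g t)) (at t within {0..1})"
      by (rule field_vector_diff_chain_within) (auto intro!: derivative_eq_intros)
    then have "((\<lambda>t. F t * exp (- g t)) has_vector_derivative
        F t * (- (F' t / F t) * exp (- g t)) + F' t * exp (- g t)) (at t within {0..1})"
      unfolding o_def by (rule has_vector_derivative_mult[OF dF[OF t]])
    then show ?thesis using nz[OF t] by simp
  qed
  then obtain c where c: "\<And>t. t \<in> {0..1} \<Longrightarrow> F t * exp (- g t) = c"
    using has_vector_derivative_zero_constant[of "{0..1::real}" "\<lambda>t. F t * exp (- g t)"] by auto
  from c[of 0] have "c = 1" by (simp add: g0 F_def f0)
  then have exp_g: "exp (g t) = F t" if "t \<in> {0..1}" for t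
    using c[OF that] by (simp add: exp_minus field_simps)
  have "distinguished_log f k = g 1"
  proof (rule distinguished_log_eqI)
    show "continuous_on {0..1} g"
      using dg by (meson continuous_on_eq_continuous_within has_vector_derivative_continuous)
  qed (use g0 exp_g in \<open>auto simp: F_def\<close>)
  moreover have "cmod (g 1) \<le> M / \<eta> * (1 - 0)"
    unfolding g_def
  proof (rule integral_bound[OF _ cont_q])
    fix t :: real assume t: "t \<in> {0..1}"
    have "cmod (F' t) / cmod (F t) \<le> M / \<eta>"
      using upper[OF t] lower[OF t] eta norm_ge_zero[of "F' t"]
      by (intro frac_le) (auto simp: F_def simp del: norm_ge_zero)
    then show "cmod (F' t / F t) \<le> M / \<eta>" by (simp add: norm_divide)
  qed simp
  ultimately show ?thesis by simp
qed

section \<open>The scaled walk\<close>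

context bound_sequence begin

definition error_term :: "nat \<Rightarrow> real \<Rightarrow> real" where
  "error_term n x = x / real n * truncated_mass b n + x\<^sup>2 / real n * moment_sum n"

lemma error_term_mono:
  assumes "0 \<le> x" "x \<le> y" "n \<ge> 1"
  shows "error_term n x \<le> error_term n y"
  unfolding error_term_def using assms truncated_mass_ge_1[OF assms(3)] moment_sum_ge_1[OF assms(3)]
  by (intro add_mono mult_right_mono divide_right_mono power_mono) auto

text \<open>
  The square of the logarithm in the hypothesis is what makes the quadratic term of the error bounded
  for \<open>x\<close> of order \<open>log n\<close>; one of the two factors is lost in passing to the tails of the series,
  which is enough for the linear term.
\<close>
lemma error_term_small:
  assumes B: "\<And>n. n \<ge> 1 \<Longrightarrow> moment_sum n \<le> B * real n / (ln (real (max n 3)))\<^sup>2"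
    and n: "n \<ge> 1" and \<delta>: "0 \<le> \<delta>" "\<delta> \<le> 1" and x: "0 \<le> x" "x \<le> \<delta> * ln (real (max n 3))"
  shows "error_term n x \<le> 19 * B * \<delta>"
proof -
  let ?l = "ln (real (max n 3))"
  have "1 \<le> ln (3::real)" using exp_le by (subst ln_ge_iff) auto
  then have l: "1 \<le> ?l" by (rule order_trans) (intro ln_mono, auto)
  have B0: "B \<ge> 0" using B by (rule log_bound_nonneg)
  have n0: "real n > 0" using n by simp
  have "B * real n / ?l\<^sup>2 \<le> B * real n / ?l"
  proof (intro divide_left_mono)
    show "?l \<le> ?l\<^sup>2" using mult_left_mono[of 1 ?l ?l] l by (simp add: power2_eq_square)
    show "0 < ?l\<^sup>2 * ?l" using l by (intro mult_pos_pos zero_less_power) linarith+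
  qed (use B0 in simp)
  moreover have "truncated_mass b n \<le> B * real n / ?l\<^sup>2 + real n * (17 * B / ?l)"
    unfolding truncated_mass_eq by (intro add_mono B n mult_left_mono tail_sum_le) auto
  moreover have "B * real n / ?l + real n * (17 * B / ?l) = 18 * B * real n / ?l"
    by (simp add: add_divide_distrib[symmetric])
  ultimately have tm: "truncated_mass b n \<le> 18 * B * real n / ?l" by linarith
  have "x / real n * truncated_mass b n \<le> \<delta> * ?l / real n * (18 * B * real n / ?l)"
    using x tm truncated_mass_ge_1[OF n] n0 \<delta> l by (intro mult_mono divide_right_mono) auto
  also have "\<dots> = 18 * B * \<delta>" using l n0 by simp
  finally have 1: "x / real n * truncated_mass b n \<le> 18 * B * \<delta>" .
  have "x\<^sup>2 / real n * moment_sum n \<le> (\<delta> * ?l)\<^sup>2 / real n * (B * real n / ?l\<^sup>2)"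
    using x moment_sum_ge_1[OF n] B[OF n] by (intro mult_mono divide_right_mono power_mono) auto
  also have "\<dots> = B * (\<delta> * \<delta>)" using l n0 by (simp add: power2_eq_square)
  also have "\<dots> \<le> B * (\<delta> * 1)" using \<delta> B0 by (intro mult_left_mono) auto
  finally show ?thesis using 1 by (simp add: error_term_def)
qed

end

context finite_range_law begin

definition theta :: "real ^ 'd" where
  "theta = mean_step + (\<Sum>i. drift (i + 2))"

text \<open>
  The scaling by \<open>n\<close> cancels the bound \<open>n L\<close> on the distance covered in \<open>n\<close> steps.
\<close>
lemma scaled_char_has_vector_derivative:
  assumes "is_walk_law p Q" "n \<ge> 1"
  obtains F' where
    "\<And>t. ((\<lambda>t. scaled_char Q n (t *\<^sub>R k)) has_vector_derivative F' t) (at t within T)"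
    "continuous_on UNIV F'" "\<And>t. cmod (F' t) \<le> L * norm k"
proof -
  let ?h = "(1 / real n) *\<^sub>R k"
  define F' where "F' t = (\<Sum>V\<in>paths L n 0. of_real (path_prob [0] V) *
        (\<i> * of_real (?h \<bullet> rvec (last (0 # V))) * wave (t *\<^sub>R ?h) (last (0 # V))))" for t
  have "((\<lambda>t. scaled_char Q n (t *\<^sub>R k)) has_vector_derivative F' t) (at t within T)" for t
    using char_from_has_vector_derivative[of ?h n t T]
    by (simp add: scaled_char_eq[OF assms(1)] F'_def scaleR_left_commute[of "1 / real n"] del: scaleR_scaleR)
  moreover have "continuous_on UNIV F'"
    unfolding F'_def wave_def by (intro continuous_intros)
  moreover have "cmod (F' t) \<le> L * norm k" for t
  proof -
    have "cmod (F' t) \<le> (\<Sum>V\<in>paths L n 0. path_prob [0] V * (L * norm k))"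
      unfolding F'_def
    proof (rule sum_norm_le)
      fix V :: "(int ^ 'd) list" assume V: "V \<in> paths L n 0"
      have "\<bar>?h \<bullet> rvec (last (0 # V))\<bar> \<le> norm ?h * norm (rvec (last (0 # V)))"
        by (rule Cauchy_Schwarz_ineq2)
      also have "\<dots> \<le> norm ?h * (L * real n)"
        using norm_last_paths[OF V] by (intro mult_left_mono) auto
      also have "\<dots> = L * norm k" using assms(2) by simp
      finally have "\<bar>?h \<bullet> rvec (last (0 # V))\<bar> \<le> L * norm k" .
      from mult_left_mono[OF this path_prob_nonneg[of "[0]" V]]
      show "cmod (of_real (path_prob [0] V) *
          (\<i> * of_real (?h \<bullet> rvec (last (0 # V))) * wave (t *\<^sub>R ?h) (last (0 # V))))
          \<le> path_prob [0] V * (L * norm k)"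
        by (simp add: norm_mult path_prob_nonneg del: last.simps inner_scaleR_left)
    qed
    then show ?thesis by (simp add: sum_path_prob flip: sum_distrib_right)
  qed
  ultimately show ?thesis by (rule that)
qed

lemma norm_distinguished_log_scaled_char_le:
  assumes Q: "is_walk_law p Q" and n: "n \<ge> 1" and \<eta>: "\<eta> > 0"
    and lower: "\<And>t. t \<in> {0..1} \<Longrightarrow> cmod (scaled_char Q n (t *\<^sub>R k)) \<ge> \<eta>"
  shows "cmod (distinguished_log (scaled_char Q n) k) \<le> L * norm k / \<eta>"
proof -
  obtain F' where F': "\<And>t. ((\<lambda>t. scaled_char Q n (t *\<^sub>R k)) has_vector_derivative F' t) (at t within {0..1})"
    "continuous_on UNIV F'" "\<And>t. cmod (F' t) \<le> L * norm k"
    using scaled_char_has_vector_derivative[OF Q n, of k "{0..1}"] by blast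
  show ?thesis
  proof (rule norm_distinguished_log_le[OF F'(1) _ _ lower \<eta> F'(3)])
    show "continuous_on {0..1} F'" using F'(2) continuous_on_subset by blast
    show "scaled_char Q n 0 = 1" by (simp add: scaled_char_eq[OF Q] char_from_0)
  qed
qed

end

lemma norm_i_cvec: "norm (\<i> *s cvec g) = norm g"
  by (simp add: norm_vec_def L2_set_def cvec_def norm_mult)

lemma bounded_linear_i_cvec: "bounded_linear (\<lambda>g :: real ^ 'd::finite. \<i> *s cvec g)"
  by (rule linear_conv_bounded_linear[THEN iffD1], rule linearI)
     (auto simp: cvec_def vec_eq_iff algebra_simps scaleR_conv_of_real[where 'a = complex])

text \<open>
  A single walk of the family, with a constant \<open>E\<close> in the role of the value of \<open>\<epsilon>\<close>.
\<close>
locale LLN_law = finite_range_law p L + bound_sequence b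
  for p :: "('d::finite) step_law" and L :: real and b :: "nat \<Rightarrow> real" +
  fixes E :: real
  assumes E_nonneg: "E \<ge> 0"
    and pi_hat_0: "\<And>m. m \<ge> 2 \<Longrightarrow> pi_hat p m 0 = 0"
    and norm_gradient_le: "\<And>m. m \<ge> 2 \<Longrightarrow> norm (gradient (pi_hat p m) 0) \<le> E * b m"
    and norm_pi_hat_le: "\<And>m k. m \<ge> 2 \<Longrightarrow> (\<And>a. k $ a \<in> {-pi..pi}) \<Longrightarrow>
      cmod (pi_hat p m k) \<le> E * norm k * b m"
    and norm_pi_hat_linear_le: "\<And>m k. m \<ge> 2 \<Longrightarrow> (\<And>a. k $ a \<in> {-pi..pi}) \<Longrightarrow>
      cmod (pi_hat p m k - cdot k (gradient (pi_hat p m) 0)) \<le> E * (norm k)\<^sup>2 * real m * b m"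
begin

lemma norm_drift_le: "m \<ge> 2 \<Longrightarrow> norm (drift m) \<le> E * b m"
  using norm_gradient_le[of m] by (simp add: gradient_pi_hat norm_i_cvec)

lemma summable_drift: "summable (\<lambda>i. drift (i + k + 2))"
proof (rule summable_comparison_test[OF _ summable_mult[OF summable_tail[of "k + 1"], of E]])
  show "\<exists>N. \<forall>i\<ge>N. norm (drift (i + k + 2)) \<le> E * b (i + (k + 1) + 1)"
    using norm_drift_le[of "_ + k + 2"] by (auto simp: add_ac)
qed

lemma norm_drift_tail_le: "norm (\<Sum>i. drift (i + k + 2)) \<le> E * tail_sum b (k + 1)"
proof -
  have "norm (\<Sum>i. drift (i + k + 2)) \<le> (\<Sum>i. E * b (i + (k + 1) + 1))"
    by (rule norm_suminf_le[OF _ summable_mult[OF summable_tail]])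
       (use norm_drift_le[of "_ + k + 2"] in \<open>auto simp: add_ac\<close>)
  also have "\<dots> = E * tail_sum b (k + 1)"
    unfolding tail_sum_def by (rule suminf_mult[OF summable_tail])
  finally show ?thesis .
qed

lemma gradient_sums:
  "(\<lambda>m. gradient (pi_hat p (m + 2)) 0) sums (\<i> *s cvec (\<Sum>i. drift (i + 2)))"
  unfolding gradient_pi_hat
  using bounded_linear.sums[OF bounded_linear_i_cvec summable_sums[OF summable_drift[of 0]]] by simp

lemma cvec_theta:
  "cvec theta = cvec mean_step - \<i> *s (\<Sum>m. gradient (pi_hat p (m + 2)) 0)"
  unfolding sums_unique[OF gradient_sums, symmetric] theta_def
  by (simp add: cvec_def vec_eq_iff flip: mult.assoc)

lemma norm_theta_le: "norm theta \<le> L + E * tail_sum b 0"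
proof -
  have "norm (\<Sum>i. drift (i + 0 + 2)) \<le> E * tail_sum b 0"
    using norm_drift_tail_le[of 0] tail_sum_le_0[of 1] E_nonneg
    by (auto elim!: order_trans intro: mult_left_mono)
  then show ?thesis
    unfolding theta_def using norm_mean_step by (intro norm_triangle_le add_mono) auto
qed

text \<open>
  Passing from \<open>n\<close> to \<open>n + 1\<close> adds to the mean all of \<open>theta\<close> except the drifts of order beyond \<open>n + 1\<close>.
\<close>
lemma norm_expected_vertex_minus_le: "norm (expected_vertex n - real n *\<^sub>R theta) \<le> E * truncated_mass b n"
proof (induction n)
  case 0
  show ?case by (simp add: expected_vertex_def truncated_mass_eq_sum_tail)
next
  case (Suc n)
  have "(\<Sum>i. drift (i + 0 + 2)) = (\<Sum>i. drift (i + n + 2)) + (\<Sum>i<n. drift (i + 2))"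
    using suminf_split_initial_segment[OF summable_drift[of 0], of n] by simp
  also have "(\<Sum>i<n. drift (i + 2)) = (\<Sum>m=2..Suc n. drift m)"
    by (rule sum.reindex_bij_witness[of _ "\<lambda>m. m - 2" "\<lambda>i. i + 2"]) auto
  finally have "expected_vertex (Suc n) - real (Suc n) *\<^sub>R theta = (expected_vertex n - real n *\<^sub>R theta) - (\<Sum>i. drift (i + n + 2))"
    by (simp add: expected_vertex_Suc[OF pi_hat_0] theta_def algebra_simps del: sum.cl_ivl_Suc)
  also have "norm \<dots> \<le> E * truncated_mass b n + E * tail_sum b n"
  proof (rule norm_triangle_le_diff, rule add_mono)
    show "norm (\<Sum>i. drift (i + n + 2)) \<le> E * tail_sum b n"
      using norm_drift_tail_le[of n] tail_sum_Suc_le[of n] E_nonneg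
      by (auto elim!: order_trans intro: mult_left_mono)
  qed (rule Suc.IH)
  finally show ?case by (simp add: truncated_mass_Suc algebra_simps)
qed

text \<open>The constant of \<open>deviation_bound\<close> for steps of length at most \<open>L\<close>.\<close>
definition dev_const :: real where
  "dev_const = E + 2 * (L + E * tail_sum b 0)\<^sup>2 + E * (1 + 3 * (L + E * tail_sum b 0))"

lemma char_from_deviation:
  assumes k: "norm k \<le> pi" and n: "n \<ge> 1"
  shows "cmod (char_from k n [0] * exp (- \<i> * of_real (k \<bullet> theta)) ^ n - 1) \<le>
     dev_const * (norm k * truncated_mass b n + real n * (norm k)\<^sup>2 * moment_sum n)"
  unfolding dev_const_def
proof (rule deviation_bound[where d = "step_hat k" and q = "\<lambda>m. pi_hat p m k" and
      g = "\<lambda>m. k \<bullet> drift m" and a = "k \<bullet> mean_step" and l = L])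
  have box: "k $ a \<in> {-pi..pi}" for a
    using component_le_norm_cart[of k a] k by auto
  show "\<bar>k \<bullet> mean_step\<bar> \<le> L * norm k"
    using Cauchy_Schwarz_ineq2[of k mean_step] mult_left_mono[OF norm_mean_step, of "norm k"]
    by (simp add: mult.commute)
  show "cmod (pi_hat p m k) \<le> E * norm k * b m" if "m \<ge> 2" for m
    using norm_pi_hat_le[OF that box] .
  have "cdot k (\<i> *s cvec g) = \<i> * of_real (k \<bullet> g)" for g
    by (simp add: cdot_def cvec_def inner_vec_def sum_distrib_left mult_ac)
  then show "cmod (pi_hat p m k - \<i> * of_real (k \<bullet> drift m)) \<le> E * (norm k)\<^sup>2 * real m * b m" if "m \<ge> 2" for m
    using norm_pi_hat_linear_le[OF that box] by (simp add: gradient_pi_hat)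
  show "\<bar>k \<bullet> drift m\<bar> \<le> E * norm k * b m" if "m \<ge> 2" for m
    using Cauchy_Schwarz_ineq2[of k "drift m"] mult_left_mono[OF norm_drift_le[OF that], of "norm k"]
    by (simp add: mult_ac)
  show "k \<bullet> theta = k \<bullet> mean_step + (\<Sum>i. k \<bullet> drift (i + 2))"
    using bounded_linear.suminf[OF bounded_linear_inner_right summable_drift[of 0], of k]
    by (simp add: theta_def inner_add_right)
  show "cmod (step_hat k - 1 - \<i> * of_real (k \<bullet> mean_step)) \<le> (L * norm k)\<^sup>2 / 2"
    by (rule norm_step_hat_minus_linear)
qed (use E_nonneg range_nonneg n in \<open>auto simp: norm_char_from_le_1 char_recursion norm_step_hat_minus_1
      simp del: char_from.simps(2)\<close>)

lemma scaled_char_deviation: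
  assumes Q: "is_walk_law p Q" and n: "n \<ge> 1" and k: "norm k \<le> pi * real n"
  shows "cmod (scaled_char Q n k * exp (- \<i> * of_real (k \<bullet> theta)) - 1) \<le> dev_const * error_term n (norm k)"
proof -
  let ?h = "(1 / real n) *\<^sub>R k"
  have "norm ?h \<le> pi" using k n by (simp add: field_simps)
  note char_from_deviation[OF this n]
  moreover have "exp (- \<i> * of_real (?h \<bullet> theta)) ^ n = exp (- \<i> * of_real (k \<bullet> theta))"
    using n by (simp flip: exp_of_nat_mult)
  moreover have "norm ?h * truncated_mass b n + real n * (norm ?h)\<^sup>2 * moment_sum n = error_term n (norm k)"
    using n by (simp add: error_term_def power2_eq_square)
  ultimately show ?thesis by (simp add: scaled_char_eq[OF Q])
qed

lemma dev_const_nonneg: "dev_const \<ge> 0"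
  unfolding dev_const_def using E_nonneg range_nonneg tail_sum_nonneg[of 0]
  by (intro add_nonneg_nonneg mult_nonneg_nonneg) auto

context
  fixes Q :: "(nat \<Rightarrow> int ^ 'd) measure" and n :: nat and k :: "real ^ 'd"
  assumes Q: "is_walk_law p Q" and n: "n \<ge> 1" and k: "norm k \<le> pi * real n"
    and small: "dev_const * error_term n (norm k) \<le> 1 / 4"
begin

text \<open>
  The characteristic function along the segment to \<open>k\<close> with the rotation by \<open>theta\<close> removed.  It stays
  in the disc of radius \<open>1 / 4\<close> around \<open>1\<close>, on which the principal logarithm is continuous.
\<close>
definition "compensated t = scaled_char Q n (t *\<^sub>R k) * exp (- \<i> * of_real (t * (k \<bullet> theta)))"

lemma compensated_deviation:
  assumes t: "t \<in> {0..1}"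
  shows "cmod (compensated t - 1) \<le> 1 / 4"
proof -
  have tk: "norm (t *\<^sub>R k) \<le> norm k" using t by (simp add: mult_left_le_one_le)
  then have "cmod (compensated t - 1) \<le> dev_const * error_term n (norm (t *\<^sub>R k))"
    using scaled_char_deviation[OF Q n, of "t *\<^sub>R k"] k by (simp add: compensated_def)
  also have "\<dots> \<le> dev_const * error_term n (norm k)"
    using tk n dev_const_nonneg by (intro mult_left_mono error_term_mono) auto
  finally show ?thesis using small by simp
qed

lemma scaled_char_lower:
  assumes t: "t \<in> {0..1}"
  shows "cmod (scaled_char Q n (t *\<^sub>R k)) \<ge> 1 / 2"
proof -
  have "cmod (exp (- \<i> * of_real (t * (k \<bullet> theta)))) = 1"
    using norm_exp_i_times[of "- (t * (k \<bullet> theta))"] by simp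
  then have "cmod (compensated t) = cmod (scaled_char Q n (t *\<^sub>R k))"
    unfolding compensated_def norm_mult by simp
  moreover have "1 \<le> cmod (compensated t) + cmod (compensated t - 1)"
    using norm_triangle_ineq4[of "compensated t" "compensated t - 1"] by simp
  ultimately show ?thesis using compensated_deviation[OF t] by simp
qed

lemma distinguished_log_small:
  "cmod (distinguished_log (scaled_char Q n) k - \<i> * of_real (k \<bullet> theta)) \<le> 2 * (dev_const * error_term n (norm k))"
proof -
  define g where "g t = \<i> * of_real (t * (k \<bullet> theta)) + Ln (compensated t)" for t
  have nonpos: "compensated t \<notin> \<real>\<^sub>\<le>\<^sub>0" if "t \<in> {0..1}" for t
  proof -
    have "\<bar>Re (compensated t - 1)\<bar> \<le> 1 / 4"
      using compensated_deviation[OF that] abs_Re_le_cmod order_trans by blast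
    then have "Re (compensated t) > 0" by (simp add: abs_if split: if_splits)
    then show ?thesis by (auto simp: complex_nonpos_Reals_iff)
  qed
  obtain F' where F': "\<And>t. ((\<lambda>t. scaled_char Q n (t *\<^sub>R k)) has_vector_derivative F' t) (at t within {0..1})"
    "continuous_on UNIV F'" "\<And>t. cmod (F' t) \<le> L * norm k"
    using scaled_char_has_vector_derivative[OF Q n, of k "{0..1}"] by blast
  from F'(1) have "continuous_on {0..1} (\<lambda>t. scaled_char Q n (t *\<^sub>R k))"
    by (rule continuous_on_vector_derivative)
  then have "continuous_on {0..1} compensated"
    unfolding compensated_def by (intro continuous_intros)
  then have cont: "continuous_on {0..1} g"
    unfolding g_def by (intro continuous_intros nonpos)
  have "distinguished_log (scaled_char Q n) k = g 1"
  proof (rule distinguished_log_eqI[OF cont])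
    show "g 0 = 0" by (simp add: g_def compensated_def scaled_char_eq[OF Q] char_from_0)
    fix t :: real assume "t \<in> {0..1}"
    then have "compensated t \<noteq> 0" using nonpos[of t] by (auto simp: complex_nonpos_Reals_iff)
    then have "exp (g t) = exp (\<i> * of_real (t * (k \<bullet> theta))) * compensated t"
      by (simp add: g_def exp_add)
    also have "\<dots> = scaled_char Q n (t *\<^sub>R k)"
      by (simp add: compensated_def exp_minus)
    finally show "exp (g t) = scaled_char Q n (t *\<^sub>R k)" .
  qed
  then have "cmod (distinguished_log (scaled_char Q n) k - \<i> * of_real (k \<bullet> theta)) = cmod (Ln (1 + (compensated 1 - 1)))"
    by (simp add: g_def)
  also have "\<dots> \<le> 2 * cmod (compensated 1 - 1)"
    using compensated_deviation[of 1] by (intro norm_Ln_le) auto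
  also have "\<dots> \<le> 2 * (dev_const * error_term n (norm k))"
    using scaled_char_deviation[OF Q n k] by (simp add: compensated_def)
  finally show ?thesis .
qed

end

end

section \<open>Asymptotics of the mean and of the characteristic function\<close>

theorem theorem4p1:
  fixes p :: "real \<Rightarrow> (int ^ 'd::finite) list \<Rightarrow> (int ^ 'd) pmf"
    and Q :: "real \<Rightarrow> (nat \<Rightarrow> int ^ 'd) measure"
    and L :: real and b :: "nat \<Rightarrow> real" and \<epsilon> :: "real \<Rightarrow> real"
  assumes "\<And>\<beta>. \<beta> \<ge> 0 \<Longrightarrow> translation_invariant (p \<beta>)"
    and "\<And>\<beta>. \<beta> \<ge> 0 \<Longrightarrow> range_at_most L (p \<beta>)"
    and "\<And>\<beta>. \<beta> \<ge> 0 \<Longrightarrow> is_walk_law (p \<beta>) (Q \<beta>)"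
    and "assumption_LLN p b \<epsilon>"
  shows "\<exists>\<beta>\<^sub>0>0. \<exists>\<theta> :: real \<Rightarrow> real ^ 'd.
    (\<forall>\<beta>\<in>{0..\<beta>\<^sub>0}.
       summable (\<lambda>m. gradient (pi_hat (p \<beta>) (m + 2)) 0) \<and>
       cvec (\<theta> \<beta>) = cvec (\<Sum>\<^sub>\<infinity>x. first_step (p \<beta>) x *\<^sub>R rvec x)
                      - \<i> *s (\<Sum>m. gradient (pi_hat (p \<beta>) (m + 2)) 0)) \<and>
    (\<exists>K. \<forall>\<beta>\<in>{0..\<beta>\<^sub>0}. \<forall>n\<ge>1.
       norm (mean_position (Q \<beta>) n - real n *\<^sub>R \<theta> \<beta>) \<le> K * truncated_mass b n) \<and>
    (\<forall>\<beta>\<in>{0..\<beta>\<^sub>0}. \<theta> \<beta> \<noteq> 0 \<longrightarrow> (\<exists>K. \<forall>n\<ge>1.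
       norm (mean_position (Q \<beta>) n - real n *\<^sub>R \<theta> \<beta>)
         \<le> norm (real n *\<^sub>R \<theta> \<beta>) * (K * (1 / real n * truncated_mass b n)))) \<and>
    (\<exists>C>0.
       (\<exists>\<delta>>0. \<forall>\<beta>\<in>{0..\<beta>\<^sub>0}. \<forall>n\<ge>1. \<forall>k. norm k \<le> \<delta> * ln (real (max n 3)) \<longrightarrow>
          (\<forall>t\<in>{0..1}. cmod (scaled_char (Q \<beta>) n (t *\<^sub>R k)) \<ge> 1 / 2)) \<and>
       (\<forall>\<eta>>0. \<exists>K. \<forall>\<beta>\<in>{0..\<beta>\<^sub>0}. \<forall>n\<ge>1. \<forall>k.
          (\<forall>t\<in>{0..1}. cmod (scaled_char (Q \<beta>) n (t *\<^sub>R k)) \<ge> \<eta>) \<longrightarrow>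
          cmod (distinguished_log (scaled_char (Q \<beta>) n) k - \<i> * complex_of_real (k \<bullet> \<theta> \<beta>))
            \<le> K * (norm k / real n * exp (C * norm k) * truncated_mass b n)
               + K * ((norm k)\<^sup>2 / real n * (\<Sum>m=1..n. real m * b m))))"
proof -
  note asm = assms(4)[unfolded assumption_LLN_def]
  interpret bound_sequence b
    by unfold_locales (use asm in auto)
  \<comment> \<open>The limit of \<open>\<epsilon>\<close> at \<open>0\<close> says nothing about its value there, which \<open>E\<close> has to bound as well.\<close>
  define E where "E = max 1 (\<bar>\<epsilon> 0\<bar>)"
  have "eventually (\<lambda>\<beta>. \<epsilon> \<beta> < 1) (at_right 0)"
    using asm by (intro order_tendstoD(2)[where y = 0]) auto
  then obtain d where d: "d > 0" "\<And>\<beta>. 0 < \<beta> \<Longrightarrow> \<beta> < d \<Longrightarrow> \<epsilon> \<beta> < 1"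
    unfolding eventually_at_right_field by auto
  define \<beta>\<^sub>0 where "\<beta>\<^sub>0 = d / 2"
  have eps: "\<epsilon> \<beta> \<le> E" if "\<beta> \<in> {0..\<beta>\<^sub>0}" for \<beta>
  proof (cases "\<beta> = 0")
    case False
    then show ?thesis using d that by (fastforce simp: \<beta>\<^sub>0_def E_def intro: less_imp_le le_max_iff_disj[THEN iffD2])
  qed (simp add: E_def)
  have law: "LLN_law (p \<beta>) L b E" if \<beta>: "\<beta> \<in> {0..\<beta>\<^sub>0}" for \<beta>
  proof -
    have \<beta>0: "\<beta> \<ge> 0" using \<beta> by simp
    have le: "\<epsilon> \<beta> * c \<le> E * c" if "c \<ge> 0" for c
      using eps[OF \<beta>] that by (rule mult_right_mono)
    note B = asm[THEN conjunct2, THEN conjunct2, THEN conjunct2, THEN conjunct1, rule_format, OF \<beta>0]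
    show ?thesis
    proof unfold_locales
      show "translation_invariant (p \<beta>)" "range_at_most L (p \<beta>)" using assms(1,2) \<beta>0 by auto
      show "E \<ge> 0" by (simp add: E_def)
    next
      fix m :: nat assume m: "m \<ge> 2"
      have bm: "b m \<ge> 0" using m by (intro b_nonneg) simp
      note Bm = B[OF m]
      show "pi_hat (p \<beta>) m 0 = 0" using Bm by blast
      show "norm (gradient (pi_hat (p \<beta>) m) 0) \<le> E * b m"
        using Bm le[OF bm] by (blast intro: order_trans)
      fix k :: "real ^ 'd" assume "\<And>a. k $ a \<in> {-pi..pi}"
      then have "cmod (pi_hat (p \<beta>) m k) \<le> \<epsilon> \<beta> * norm k * b m"
        "cmod (pi_hat (p \<beta>) m k - cdot k (gradient (pi_hat (p \<beta>) m) 0)) \<le> \<epsilon> \<beta> * (norm k)\<^sup>2 * real m * b m"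
        using Bm by blast+
      then show "cmod (pi_hat (p \<beta>) m k) \<le> E * norm k * b m"
        "cmod (pi_hat (p \<beta>) m k - cdot k (gradient (pi_hat (p \<beta>) m) 0)) \<le> E * (norm k)\<^sup>2 * real m * b m"
        using le[of "norm k * b m"] le[of "(norm k)\<^sup>2 * real m * b m"] bm by (auto simp: mult.assoc)
    qed
  qed
  have walk: "is_walk_law (p \<beta>) (Q \<beta>)" if "\<beta> \<in> {0..\<beta>\<^sub>0}" for \<beta>
    using assms(3) that by simp
  define \<theta> where "\<theta> \<beta> = finite_range_law.theta (p \<beta>) L" for \<beta>
  have "0 \<in> {0..\<beta>\<^sub>0}" using d by (simp add: \<beta>\<^sub>0_def)
  note law0 = law[OF this]
  have fr: "finite_range_law (p \<beta>) L" if "\<beta> \<in> {0..\<beta>\<^sub>0}" for \<beta>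
    using law[OF that] by (simp add: LLN_law_def)
  have E1: "E \<ge> 1" by (simp add: E_def)
  have L0: "L \<ge> 0" using finite_range_law.range_nonneg[OF fr] \<open>0 \<in> {0..\<beta>\<^sub>0}\<close> by blast
  have mean_bound: "norm (mean_position (Q \<beta>) n - real n *\<^sub>R \<theta> \<beta>) \<le> E * truncated_mass b n"
    if "\<beta> \<in> {0..\<beta>\<^sub>0}" for \<beta> n
    using LLN_law.norm_expected_vertex_minus_le[OF law[OF that]]
    by (simp add: finite_range_law.mean_position_eq[OF fr[OF that] walk[OF that]] \<theta>_def)
  define K where "K = LLN_law.dev_const L b E"
  have K0: "K \<ge> 0" unfolding K_def by (rule LLN_law.dev_const_nonneg[OF law0])
  have "bdd_above ((\<lambda>n. (ln (real (max n 3)))\<^sup>2 / real n * moment_sum n) ` {1..})"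
    using asm by (elim conjE)
  then obtain B where "\<forall>x\<in>(\<lambda>n. (ln (real (max n 3)))\<^sup>2 / real n * moment_sum n) ` {1..}. x \<le> B"
    unfolding bdd_above_def by blast
  then have B: "(ln (real (max n 3)))\<^sup>2 / real n * moment_sum n \<le> B" if "n \<ge> 1" for n
    using that by (elim ballE[where x = "(ln (real (max n 3)))\<^sup>2 / real n * moment_sum n"]) auto
  have moment_sum_le: "moment_sum n \<le> B * real n / (ln (real (max n 3)))\<^sup>2" if n: "n \<ge> 1" for n
  proof -
    have "ln (real (max n 3)) > 0" by simp
    then show ?thesis using B[OF n] n by (simp add: field_simps)
  qed
  have B0: "B \<ge> 0" using moment_sum_le by (rule log_bound_nonneg)
  \<comment> \<open>For \<open>norm k\<close> up to \<open>\<delta> log n\<close> the deviation is at most \<open>19 K B \<delta>\<close>, which must not exceed \<open>1 / 4\<close>.\<close>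
  define \<delta> where "\<delta> = 1 / (76 * (K * B + 1))"
  have KB: "K * B \<ge> 0" using K0 B0 by simp
  have \<delta>: "\<delta> > 0" "\<delta> \<le> 1" using KB by (auto simp: \<delta>_def divide_simps)
  \<comment> \<open>This puts \<open>k / n\<close> into the cube on which the coefficients are controlled.\<close>
  have ln_le: "ln (real (max n 3)) \<le> pi * real n" if "n \<ge> 1" for n
  proof -
    have "ln (real (max n 3)) \<le> real (max n 3) - 1" by (intro ln_le_minus_one) auto
    also have "\<dots> \<le> 2 * real n" using that by auto
    also have "\<dots> \<le> pi * real n" using pi_ge_two by (intro mult_right_mono) auto
    finally show ?thesis .
  qed
  have small: "norm k \<le> pi * real n \<and> K * error_term n (norm k) \<le> 1 / 4"
    if n: "n \<ge> 1" and k: "norm k \<le> \<delta> * ln (real (max n 3))" for n and k :: "real ^ 'd"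
  proof
    have "\<delta> * ln (real (max n 3)) \<le> 1 * ln (real (max n 3))"
      using \<delta> by (intro mult_right_mono) auto
    then show "norm k \<le> pi * real n" using k ln_le[OF n] by simp
    have "K * error_term n (norm k) \<le> K * (19 * B * \<delta>)"
      using error_term_small[OF moment_sum_le n _ _ _ k] \<delta> K0 by (intro mult_left_mono) auto
    also have "\<dots> \<le> 1 / 4" using KB by (simp add: \<delta>_def divide_simps)
    finally show "K * error_term n (norm k) \<le> 1 / 4" .
  qed
  have lower: "cmod (scaled_char (Q \<beta>) n (t *\<^sub>R k)) \<ge> 1 / 2"
    if "\<beta> \<in> {0..\<beta>\<^sub>0}" "n \<ge> 1" "norm k \<le> \<delta> * ln (real (max n 3))" "t \<in> {0..1}" for \<beta> n k t
    using LLN_law.scaled_char_lower[OF law[OF that(1)] walk[OF that(1)] that(2) _ _ that(4)]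
      small[OF that(2,3)] by (simp add: K_def)
  \<comment> \<open>In the constant, \<open>2 * K\<close> serves the region of small \<open>k\<close>; the other summands bound, for large \<open>k\<close>, the
      logarithm and \<open>k \<bullet> \<theta> \<beta>\<close> separately.\<close>
  have log_bound: "cmod (distinguished_log (scaled_char (Q \<beta>) n) k - \<i> * of_real (k \<bullet> \<theta> \<beta>))
      \<le> (2 * K + L / \<eta> + L + E * tail_sum b 0) * (norm k / real n * exp (1 / \<delta> * norm k) * truncated_mass b n)
        + (2 * K + L / \<eta> + L + E * tail_sum b 0) * ((norm k)\<^sup>2 / real n * moment_sum n)"
    if \<beta>: "\<beta> \<in> {0..\<beta>\<^sub>0}" and n: "n \<ge> 1" and \<eta>: "\<eta> > 0"
      and big: "\<And>t. t \<in> {0..1} \<Longrightarrow> cmod (scaled_char (Q \<beta>) n (t *\<^sub>R k)) \<ge> \<eta>" for \<beta> n k \<eta>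
  proof -
    let ?M = "2 * K + L / \<eta> + L + E * tail_sum b 0"
    have parts: "2 * K \<le> ?M" "L / \<eta> + L + E * tail_sum b 0 \<le> ?M" "?M \<ge> 0"
      using K0 L0 E1 tail_sum_nonneg[of 0] \<eta> by auto
    have tm: "truncated_mass b n \<ge> 1" and Sn: "moment_sum n \<ge> 1"
      using truncated_mass_ge_1[OF n] moment_sum_ge_1[OF n] by auto
    show ?thesis
    proof (cases "norm k \<le> \<delta> * ln (real (max n 3))")
      case True
      have "cmod (distinguished_log (scaled_char (Q \<beta>) n) k - \<i> * of_real (k \<bullet> \<theta> \<beta>))
          \<le> 2 * (K * error_term n (norm k))"
        using LLN_law.distinguished_log_small[OF law[OF \<beta>] walk[OF \<beta>] n] small[OF n True]
        by (simp add: K_def \<theta>_def)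
      also have "\<dots> = 2 * K * (norm k / real n * 1 * truncated_mass b n) + 2 * K * ((norm k)\<^sup>2 / real n * moment_sum n)"
        by (simp add: error_term_def algebra_simps)
      also have "\<dots> \<le> ?M * (norm k / real n * exp (1 / \<delta> * norm k) * truncated_mass b n)
          + ?M * ((norm k)\<^sup>2 / real n * moment_sum n)"
        using parts K0 tm Sn \<delta> by (intro add_mono mult_mono mult_left_mono) auto
      finally show ?thesis .
    next
      case False
      have "real n \<le> exp (ln (real (max n 3)))" by simp
      also have "\<dots> \<le> exp (1 / \<delta> * norm k)"
        unfolding exp_le_cancel_iff using False \<delta> by (simp add: field_simps)
      finally have exp_ge: "real n \<le> exp (1 / \<delta> * norm k)" .
      have "norm k = norm k / real n * real n * 1" using n by simp
      also have "\<dots> \<le> norm k / real n * exp (1 / \<delta> * norm k) * truncated_mass b n"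
        using exp_ge tm by (intro mult_mono mult_left_mono) auto
      finally have k_le: "norm k \<le> norm k / real n * exp (1 / \<delta> * norm k) * truncated_mass b n" .
      have "\<bar>k \<bullet> \<theta> \<beta>\<bar> \<le> norm k * (L + E * tail_sum b 0)"
        using Cauchy_Schwarz_ineq2[of k "\<theta> \<beta>"] LLN_law.norm_theta_le[OF law[OF \<beta>]]
        by (auto simp: \<theta>_def elim!: order_trans intro: mult_left_mono)
      moreover have "cmod (distinguished_log (scaled_char (Q \<beta>) n) k) \<le> L * norm k / \<eta>"
        by (rule finite_range_law.norm_distinguished_log_scaled_char_le[OF fr[OF \<beta>] walk[OF \<beta>] n \<eta> big])
      ultimately have "cmod (distinguished_log (scaled_char (Q \<beta>) n) k - \<i> * of_real (k \<bullet> \<theta> \<beta>))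
          \<le> L * norm k / \<eta> + norm k * (L + E * tail_sum b 0)"
        by (intro norm_triangle_le_diff add_mono) (auto simp: norm_mult)
      also have "\<dots> = (L / \<eta> + L + E * tail_sum b 0) * norm k" by (simp add: algebra_simps)
      also have "\<dots> \<le> ?M * (norm k / real n * exp (1 / \<delta> * norm k) * truncated_mass b n)"
        using parts k_le by (intro mult_mono) auto
      also have "\<dots> \<le> \<dots> + ?M * ((norm k)\<^sup>2 / real n * moment_sum n)"
        using parts Sn by simp
      finally show ?thesis .
    qed
  qed
  show ?thesis
  proof (rule exI[of _ \<beta>\<^sub>0], rule conjI, goal_cases)
    case 1
    show ?case using d by (simp add: \<beta>\<^sub>0_def)
  next
    case 2
    show ?case
    proof (rule exI[of _ \<theta>], intro conjI ballI)
      fix \<beta> assume \<beta>: "\<beta> \<in> {0..\<beta>\<^sub>0}"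
      show "summable (\<lambda>m. gradient (pi_hat (p \<beta>) (m + 2)) 0)"
        using LLN_law.gradient_sums[OF law[OF \<beta>]] by (rule sums_summable)
      show "cvec (\<theta> \<beta>) = cvec (\<Sum>\<^sub>\<infinity>x. first_step (p \<beta>) x *\<^sub>R rvec x)
                        - \<i> *s (\<Sum>m. gradient (pi_hat (p \<beta>) (m + 2)) 0)"
        using LLN_law.cvec_theta[OF law[OF \<beta>]]
        by (simp add: \<theta>_def finite_range_law.infsum_first_step[OF fr[OF \<beta>]])
    next
      show "\<exists>K. \<forall>\<beta>\<in>{0..\<beta>\<^sub>0}. \<forall>n\<ge>1.
         norm (mean_position (Q \<beta>) n - real n *\<^sub>R \<theta> \<beta>) \<le> K * truncated_mass b n"
        using mean_bound by blast
    next
      fix \<beta> assume \<beta>: "\<beta> \<in> {0..\<beta>\<^sub>0}"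
      show "\<theta> \<beta> \<noteq> 0 \<longrightarrow> (\<exists>K. \<forall>n\<ge>1.
         norm (mean_position (Q \<beta>) n - real n *\<^sub>R \<theta> \<beta>)
           \<le> norm (real n *\<^sub>R \<theta> \<beta>) * (K * (1 / real n * truncated_mass b n)))"
      proof (intro impI exI[of _ "E / norm (\<theta> \<beta>)"] allI)
        fix n :: nat assume "\<theta> \<beta> \<noteq> 0" "n \<ge> 1"
        then show "norm (mean_position (Q \<beta>) n - real n *\<^sub>R \<theta> \<beta>)
           \<le> norm (real n *\<^sub>R \<theta> \<beta>) * (E / norm (\<theta> \<beta>) * (1 / real n * truncated_mass b n))"
          using mean_bound[OF \<beta>, of n] by simp
      qed
    next
      show "\<exists>C>0.
         (\<exists>\<delta>>0. \<forall>\<beta>\<in>{0..\<beta>\<^sub>0}. \<forall>n\<ge>1. \<forall>k. norm k \<le> \<delta> * ln (real (max n 3)) \<longrightarrow>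
            (\<forall>t\<in>{0..1}. cmod (scaled_char (Q \<beta>) n (t *\<^sub>R k)) \<ge> 1 / 2)) \<and>
         (\<forall>\<eta>>0. \<exists>K. \<forall>\<beta>\<in>{0..\<beta>\<^sub>0}. \<forall>n\<ge>1. \<forall>k.
            (\<forall>t\<in>{0..1}. cmod (scaled_char (Q \<beta>) n (t *\<^sub>R k)) \<ge> \<eta>) \<longrightarrow>
            cmod (distinguished_log (scaled_char (Q \<beta>) n) k - \<i> * complex_of_real (k \<bullet> \<theta> \<beta>))
              \<le> K * (norm k / real n * exp (C * norm k) * truncated_mass b n)
                 + K * ((norm k)\<^sup>2 / real n * (\<Sum>m=1..n. real m * b m)))"
      proof (rule exI[of _ "1 / \<delta>"], intro conjI)
        show "1 / \<delta> > 0" using \<delta> by simp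
        show "\<exists>\<delta>>0. \<forall>\<beta>\<in>{0..\<beta>\<^sub>0}. \<forall>n\<ge>1. \<forall>k. norm k \<le> \<delta> * ln (real (max n 3)) \<longrightarrow>
            (\<forall>t\<in>{0..1}. cmod (scaled_char (Q \<beta>) n (t *\<^sub>R k)) \<ge> 1 / 2)"
          using \<delta>(1) lower by blast
        show "\<forall>\<eta>>0. \<exists>K. \<forall>\<beta>\<in>{0..\<beta>\<^sub>0}. \<forall>n\<ge>1. \<forall>k.
            (\<forall>t\<in>{0..1}. cmod (scaled_char (Q \<beta>) n (t *\<^sub>R k)) \<ge> \<eta>) \<longrightarrow>
            cmod (distinguished_log (scaled_char (Q \<beta>) n) k - \<i> * complex_of_real (k \<bullet> \<theta> \<beta>))
              \<le> K * (norm k / real n * exp (1 / \<delta> * norm k) * truncated_mass b n)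
                 + K * ((norm k)\<^sup>2 / real n * (\<Sum>m=1..n. real m * b m))"
        proof (intro allI impI)
          fix \<eta> :: real assume "\<eta> > 0"
          then show "\<exists>K. \<forall>\<beta>\<in>{0..\<beta>\<^sub>0}. \<forall>n\<ge>1. \<forall>k.
            (\<forall>t\<in>{0..1}. cmod (scaled_char (Q \<beta>) n (t *\<^sub>R k)) \<ge> \<eta>) \<longrightarrow>
            cmod (distinguished_log (scaled_char (Q \<beta>) n) k - \<i> * complex_of_real (k \<bullet> \<theta> \<beta>))
              \<le> K * (norm k / real n * exp (1 / \<delta> * norm k) * truncated_mass b n)
                 + K * ((norm k)\<^sup>2 / real n * (\<Sum>m=1..n. real m * b m))"
            by (intro exI[of _ "2 * K + L / \<eta> + L + E * tail_sum b 0"] ballI allI impI log_bound) auto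
        qed
      qed
    qed
  qed
qed

end
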